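(* Let $D\subset\mathbb{C}^{n}$ be a pseudoconvex Reinhardt domain. Fix $z_{0}\in D$ and $\zeta_0\in\partial D$. Then there exist a constant $C\in\mathbb{R}$ and an open neighbourhood $U\subset\mathbb{C}^n$ of $\zeta_0$ such that $$k_{D}(z_{0},z)\leq-\log d_{D}(z)+C\qquad\text{for all } z\in D\cap U.$$ Additionally, if $\zeta_0\in\mathbb{C}^{n}_{*}$ (that is, all coordinates of $\zeta_0$ are non-zero), then there exist a constant $C'\in\mathbb{R}$ and an open neighbourhood $U'\subset\mathbb{C}^n$ of $\zeta_0$ such that $$k_{D}(z_{0},z)\leq-\frac{1}{2}\log d_{D}(z)+C'\qquad\text{for all } z\in D\cap U'.$$
   Context: A domain is a non-empty connected open set. A domain $D\subset\mathbb{C}^n$ is a Reinhardt domain if $(\lambda_{1}z_{1},\ldots,\lambda_{n}z_{n})\in D$ for all $z\in D$ and all $\lambda_1,\ldots,\lambda_n\in\mathbb{C}$ with $|\lambda_j|=1$. Write $\mathbb{C}_*=\mathbb{C}\setminus\{0\}$ and $\mathbb{C}^n_*=(\mathbb{C}_* )^n$. For $z\in D$, $d_D(z)$ denotes the Euclidean distance from $z$ to $\partial D$. Let $\mathbb{D}\subset\mathbb{C}$ be the unit disc and $p$ the Poincaré distance on $\mathbb{D}$, normalized by $p(\lambda,\mu)=\tanh^{-1}\left|\frac{\lambda-\mu}{1-\overline{\mu}\lambda}\right|$, so that $p(0,\lambda)=\frac12\log\frac{1+|\lambda|}{1-|\lambda|}$. The Lempert function of $D$ is $$\widetilde{k}_{D}(w,z):=\inf\{p(\lambda,\mu):\lambda,\mu\in\mathbb{D}\text{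 and there is a holomorphic } f:\mathbb{D}\to D \text{ with } f(\lambda)=w,\ f(\mu)=z\}.$$ The Kobayashi (pseudo)distance $k_D$ is the largest pseudodistance on $D$ that is less than or equal to $\widetilde{k}_D$; equivalently, $k_D(w,z)$ is the infimum of $\sum_{j=1}^{N}\widetilde{k}_D(w_{j-1},w_j)$ over all $N\geq 1$ and all finite chains $w=w_0,w_1,\ldots,w_N=z$ in $D$. *)

theory Defs
  imports "HOL-Analysis.Analysis"
begin

section \<open>Domains in \<open>\<complex>\<^sup>n\<close>\<close>

definition domain_Cn :: "(complex ^ 'n) set \<Rightarrow> bool" where
  "domain_Cn D \<longleftrightarrow> D \<noteq> {} \<and> open D \<and> connected D"

definition Reinhardt :: "(complex ^ 'n) set \<Rightarrow> bool" where
  "Reinhardt D \<longleftrightarrow> domain_Cn D \<and>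
     (\<forall>z\<in>D. \<forall>l :: complex ^ 'n. (\<forall>j. cmod (l $ j) = 1) \<longrightarrow> (\<chi> j. l $ j * z $ j) \<in> D)"

text \<open>The Euclidean distance to the boundary. It is only meaningful when
  \<open>frontier D \<noteq> {}\<close>, since \<^const>\<open>infdist\<close> to the empty set is \<open>0\<close>.\<close>

definition bdist :: "(complex ^ 'n) set \<Rightarrow> complex ^ 'n \<Rightarrow> real" where
  "bdist D z = infdist z (frontier D)"

section \<open>Pseudoconvexity\<close>

definition usc_on :: "'a::topological_space set \<Rightarrow> ('a \<Rightarrow> real) \<Rightarrow> bool" where
  "usc_on S u \<longleftrightarrow> (\<forall>c. openin (top_of_set S) {x \<in> S. u x < c})"

text \<open>Subharmonicity by the sub-mean value property on closed discs. The value \<open>-\<infinity>\<close> is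
  not admitted, as it is not needed for \<open>-ln (bdist D z)\<close>; for a real-valued subharmonic
  function the circle means are finite, so integrability is part of the definition and the
  integral below is never a default value.\<close>

definition subharmonic_on :: "complex set \<Rightarrow> (complex \<Rightarrow> real) \<Rightarrow> bool" where
  "subharmonic_on S u \<longleftrightarrow> usc_on S u \<and>
     (\<forall>a r. 0 < r \<and> cball a r \<subseteq> S \<longrightarrow>
        set_integrable lborel {0..2 * pi} (\<lambda>t. u (a + of_real r * cis t)) \<and>
        u a \<le> 1 / (2 * pi) * (LINT t:{0..2 * pi}|lborel. u (a + of_real r * cis t)))"

definition plurisubharmonic_on :: "(complex ^ 'n) set \<Rightarrow> (complex ^ 'n \<Rightarrow> real) \<Rightarrow> bool" where
  "plurisubharmonic_on D u \<longleftrightarrow> usc_on D u \<and>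
     (\<forall>a\<in>D. \<forall>b. subharmonic_on {l. a + l *s b \<in> D} (\<lambda>l. u (a + l *s b)))"

text \<open>For \<open>D = \<complex>\<^sup>n\<close> the distance to the boundary is \<open>\<infinity>\<close>, so \<open>-ln (bdist D z)\<close> is to be read
  as the constant \<open>-\<infinity>\<close>, which is plurisubharmonic; hence the separate case.\<close>

definition pseudoconvex :: "(complex ^ 'n) set \<Rightarrow> bool" where
  "pseudoconvex D \<longleftrightarrow> D = UNIV \<or> plurisubharmonic_on D (\<lambda>z. - ln (bdist D z))"

section \<open>The Lempert function and the Kobayashi pseudodistance\<close>

definition poincare_dist :: "complex \<Rightarrow> complex \<Rightarrow> real" where
  "poincare_dist l m = artanh (cmod ((l - m) / (1 - cnj m * l)))"

definition holomorphic_disc :: "(complex ^ 'n) set \<Rightarrow> (complex \<Rightarrow> complex ^ 'n) \<Rightarrow> bool" where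
  "holomorphic_disc D f \<longleftrightarrow>
     (\<forall>j. (\<lambda>l. f l $ j) holomorphic_on ball 0 1) \<and> f ` ball 0 1 \<subseteq> D"

text \<open>The infima are taken in \<^typ>\<open>ereal\<close>, so that an empty infimum would be \<open>\<infinity>\<close>.\<close>

definition lempert :: "(complex ^ 'n) set \<Rightarrow> complex ^ 'n \<Rightarrow> complex ^ 'n \<Rightarrow> ereal" where
  "lempert D w z = Inf {ereal (poincare_dist l m) | l m.
     l \<in> ball 0 1 \<and> m \<in> ball 0 1 \<and> (\<exists>f. holomorphic_disc D f \<and> f l = w \<and> f m = z)}"

definition kobayashi :: "(complex ^ 'n) set \<Rightarrow> complex ^ 'n \<Rightarrow> complex ^ 'n \<Rightarrow> ereal" where
  "kobayashi D w z = Inf {(\<Sum>j=1..N. lempert D (c (j - 1)) (c j)) | (N::nat) c.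
     1 \<le> N \<and> (\<forall>j\<le>N. c j \<in> D) \<and> c 0 = w \<and> c N = z}"

end

theory Submission
  imports Defs "HOL-Complex_Analysis.Cauchy_Integral_Formula"
begin

text \<open>Only one consequence of pseudoconvexity is needed: the logarithmic image \<open>G\<close> of \<open>D\<close> is
  convex. Along the affine disc \<open>l \<mapsto> (z\<^sub>j (1 + l v\<^sub>j))\<^sub>j\<close> the logarithmic coordinates move by
  \<open>ln \<bar>1 + l v\<^sub>j\<bar>\<close>, which has mean \<open>0\<close> over circles and equals \<open>Re l v\<^sub>j\<close> up to second order; so the
  sub-mean value property of \<open>- ln (bdist D)\<close> along these discs yields a maximum principle on
  segments in \<open>G\<close>, and a continuity argument turns it into convexity.

  If \<open>G\<close> contains an \<open>r\<close>-ball about \<open>x\<^sub>0\<close> and an \<open>s\<close>-ball about \<open>x\<close>, then the segment from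
  \<open>x\<^sub>0\<close> to \<open>x\<close> may be prolonged at both ends, and exponentiating the disc over it joins the
  points with moduli \<open>exp x\<^sub>0\<close> and \<open>exp x\<close> at cost \<open>ln \<bar>x - x\<^sub>0\<bar> - (ln r + ln s) / 2 + O(1)\<close>. One can
  take \<open>s\<close> proportional to the boundary distance \<open>d\<close>. Away from the coordinate hyperplanes
  \<open>\<bar>x - x\<^sub>0\<bar>\<close> is bounded, which gives the factor \<open>1/2\<close>. In general the point is first moved inside
  the ball of radius \<open>d\<close> about it until all coordinates have modulus at least a multiple of \<open>d\<close>; then
  \<open>\<bar>x - x\<^sub>0\<bar>\<close> is \<open>O(ln (1/d))\<close> and \<open>ln \<bar>x - x\<^sub>0\<bar>\<close> is absorbed by the other half of
  \<open>- ln d\<close>.\<close>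

section \<open>Logarithmic coordinates\<close>

definition vexp :: "complex ^ 'n \<Rightarrow> complex ^ 'n" where
  "vexp c = (\<chi> j. exp (c $ j))"

definition cplx :: "real ^ 'n \<Rightarrow> complex ^ 'n" where
  "cplx x = (\<chi> j. of_real (x $ j))"

text \<open>Points of \<open>D\<close> with a zero coordinate leave no trace here. For a Reinhardt
  \<open>D\<close> this is the usual logarithmic image, since membership in \<open>D\<close> then
  depends on the moduli alone.\<close>

definition log_image :: "(complex ^ 'n) set \<Rightarrow> (real ^ 'n) set" where
  "log_image D = {x. vexp (cplx x) \<in> D}"

text \<open>At a zero coordinate the entry is the default \<open>ln 0 = 0\<close>, so the vector
  represents the moduli only off the coordinate hyperplanes.\<close>

definition log_vec :: "complex ^ 'n \<Rightarrow> real ^ 'n" where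
  "log_vec z = (\<chi> j. ln (cmod (z $ j)))"

lemma vexp_nth [simp]: "vexp c $ j = exp (c $ j)"
  by (simp add: vexp_def)

lemma cplx_nth [simp]: "cplx x $ j = of_real (x $ j)"
  by (simp add: cplx_def)

lemma log_vec_nth [simp]: "log_vec z $ j = ln (cmod (z $ j))"
  by (simp add: log_vec_def)

lemma log_vec_vexp_cplx [simp]: "log_vec (vexp (cplx x)) = x"
  by (simp add: vec_eq_iff)

lemma norm_cvec_le_sum: "norm (z :: complex ^ 'n) \<le> (\<Sum>j\<in>UNIV. cmod (z $ j))"
  by (simp add: norm_vec_def L2_set_le_sum)

lemma continuous_on_vexp_cplx: "continuous_on S (\<lambda>x. vexp (cplx x))"
  unfolding vexp_def cplx_def by (intro continuous_intros) 

lemma open_log_image: "open D \<Longrightarrow> open (log_image D)"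
  unfolding log_image_def
  using open_vimage[OF _ continuous_on_vexp_cplx, of D] by (simp add: vimage_def)

section \<open>Rotations and the symmetry of Reinhardt domains\<close>

definition rot :: "complex ^ 'n \<Rightarrow> complex ^ 'n \<Rightarrow> complex ^ 'n" where
  "rot l z = (\<chi> j. l $ j * z $ j)"

lemma dist_rot:
  assumes "\<And>j. cmod (l $ j) = 1"
  shows "dist (rot l z) (rot l w) = dist z w"
  using assms by (simp add: rot_def dist_vec_def dist_norm norm_mult flip: right_diff_distrib)

lemma rot_cancel:
  assumes "\<And>j. cmod (l $ j) = 1"
  shows "rot (\<chi> j. cnj (l $ j)) (rot l z) = z"
  using assms by (simp add: rot_def vec_eq_iff complex_mult_cnj cmod_def mult.commute
     complex_norm_square[symmetric] flip: mult.assoc)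

lemma rot_exists:
  assumes "\<And>j. cmod (z $ j) = cmod (w $ j)"
  obtains l :: "complex ^ 'n" where "\<And>j. cmod (l $ j) = 1" "rot l z = w"
proof (rule that)
  \<comment> \<open>Where \<open>z $ j\<close> vanishes, so does \<open>w $ j\<close>, and any
    unimodular factor serves.\<close>
  let ?l = "(\<chi> j. if z $ j = 0 then 1 else w $ j / z $ j) :: complex ^ 'n"
  show "cmod (?l $ j) = 1" for j
    using assms[of j] by (auto simp: norm_divide)
  show "rot ?l z = w"
    using assms by (simp add: rot_def vec_eq_iff) (metis norm_eq_zero)
qed

context
  fixes D :: "(complex ^ 'n) set"
  assumes R: "Reinhardt D"
begin

lemma Reinhardt_open: "open D" and Reinhardt_connected: "connected D"
  using R by (auto simp: Reinhardt_def domain_Cn_def)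

lemma Reinhardt_rot: "z \<in> D \<Longrightarrow> (\<And>j. cmod (l $ j) = 1) \<Longrightarrow> rot l z \<in> D"
  using R by (simp add: Reinhardt_def rot_def)

lemma Reinhardt_rot_iff:
  assumes l: "\<And>j. cmod (l $ j) = 1"
  shows "rot l z \<in> D \<longleftrightarrow> z \<in> D"
proof
  assume "rot l z \<in> D"
  then have "rot (\<chi> j. cnj (l $ j)) (rot l z) \<in> D"
    by (rule Reinhardt_rot) (simp add: l)
  then show "z \<in> D" by (simp add: rot_cancel[OF l])
qed (simp add: Reinhardt_rot l)

lemma Reinhardt_cong:
  assumes "\<And>j. cmod (z $ j) = cmod (w $ j)"
  shows "z \<in> D \<longleftrightarrow> w \<in> D"
  using rot_exists[OF assms] Reinhardt_rot_iff by metis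

lemma vexp_in_iff: "vexp c \<in> D \<longleftrightarrow> (\<chi> j. Re (c $ j)) \<in> log_image D"
  unfolding log_image_def mem_Collect_eq by (rule Reinhardt_cong) simp

lemma mem_iff_log_vec:
  assumes "\<And>j. z $ j \<noteq> 0"
  shows "z \<in> D \<longleftrightarrow> log_vec z \<in> log_image D"
  unfolding log_image_def mem_Collect_eq
  by (rule Reinhardt_cong) (simp add: assms flip: exp_of_real)

text \<open>A rotation is an isometry preserving both \<open>D\<close> and its complement, so points
  of either set near \<open>z\<close> go to points of the same set equally near
  \<open>rot l z\<close>.\<close>

lemma frontier_rot:
  assumes l: "\<And>j. cmod (l $ j) = 1" and "z \<in> frontier D"
  shows "rot l z \<in> frontier D"
proof -
  have "\<exists>x\<in>D. dist (rot l z) x < e" "\<exists>x. x \<notin> D \<and> dist (rot l z) x < e" if "e > 0" for e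
  proof -
    obtain x y where "x \<in> D" "dist z x < e" "y \<notin> D" "dist z y < e"
      using assms(2) \<open>e > 0\<close> by (auto simp: frontier_straddle)
    then show "\<exists>x\<in>D. dist (rot l z) x < e" "\<exists>x. x \<notin> D \<and> dist (rot l z) x < e"
      using Reinhardt_rot_iff[OF l] dist_rot[OF l] by metis+
  qed
  then show ?thesis by (simp add: frontier_straddle)
qed

text \<open>Rotating a frontier point nearest to \<open>z\<close> gives a frontier point equally far
  from \<open>w\<close>, which bounds one distance by the other; the roles are then
  exchanged.\<close>

lemma bdist_cong:
  assumes "\<And>j. cmod (z $ j) = cmod (w $ j)"
  shows "bdist D z = bdist D w"
proof -
  have le: "bdist D w \<le> bdist D z" if "\<And>j. cmod (z $ j) = cmod (w $ j)" for z w
  proof (cases "frontier D = {}")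
    case False
    obtain l where l: "\<And>j. cmod (l $ j) = 1" "rot l z = w"
      using rot_exists[OF \<open>\<And>j. cmod (z $ j) = cmod (w $ j)\<close>] by blast
    obtain y where y: "y \<in> frontier D" "infdist z (frontier D) = dist z y"
      using infdist_attains_inf[OF frontier_closed False] by blast
    have "infdist w (frontier D) \<le> dist w (rot l y)"
      by (rule infdist_le) (rule frontier_rot[OF l(1) y(1)])
    also have "\<dots> = dist z y"
      using dist_rot[OF l(1), of z y] l(2) by simp
    finally show ?thesis using y by (simp add: bdist_def)
  qed (simp add: bdist_def infdist_def)
  show ?thesis
    using le[of z w] le[of w z] assms by simp
qed

end

section \<open>Elementary properties of the boundary distance\<close>

lemma ball_bdist_subset:
  assumes "z \<in> D"
  shows "ball z (bdist D z) \<subseteq> D"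
proof
  fix w assume w: "w \<in> ball z (bdist D z)"
  show "w \<in> D"
  proof (rule ccontr)
    assume "w \<notin> D"
    moreover have "z \<in> ball z (bdist D z)"
      using w by (auto intro: order.strict_trans1[OF zero_le_dist])
    \<comment> \<open>A connected set meeting both \<open>D\<close> and its complement meets the
      frontier, here at a distance below the infimum.\<close>
    ultimately have "ball z (bdist D z) \<inter> frontier D \<noteq> {}"
      using w assms by (intro connected_Int_frontier connected_ball) blast+
    then obtain y where "y \<in> frontier D" "dist z y < bdist D z" by auto
    then show False
      using infdist_le[of y "frontier D" z] by (simp add: bdist_def)
  qed
qed

lemma bdist_pos:
  assumes "open D" "z \<in> D" "frontier D \<noteq> {}"
  shows "bdist D z > 0"
  unfolding bdist_def
  by (rule infdist_pos_not_in_closed) (use assms in \<open>auto simp: frontier_def interior_open\<close>)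

lemma bdist_triangle: "bdist D z \<le> bdist D w + dist z w"
  unfolding bdist_def by (rule infdist_triangle)

lemma continuous_on_bdist: "continuous_on S (bdist D)"
  unfolding bdist_def by (intro continuous_intros)

text \<open>The mean value property of the harmonic function \<open>Re (Ln (1 + v * u))\<close>,
  which vanishes at \<open>u = 0\<close>; on the disc in question \<open>1 + v * u\<close> stays in
  the right half-plane, off the branch cut.\<close>

lemma integral_ln_cmod_circle:
  assumes "\<rho> > 0" "\<rho> * \<bar>v\<bar> < 1"
  shows "((\<lambda>t. ln (cmod (1 + of_real v * (of_real \<rho> * cis t)))) has_integral 0) {0..2 * pi}"
proof -
  have nz: "1 + of_real v * u \<notin> \<real>\<^sub>\<le>\<^sub>0" if "u \<in> cball 0 \<rho>" for u :: complex
  proof -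
    have "cmod (of_real v * u) \<le> \<bar>v\<bar> * \<rho>"
      using that by (simp add: norm_mult mult_left_mono)
    also have "\<dots> < 1" using assms by (simp add: mult.commute)
    finally have "\<bar>Re (of_real v * u)\<bar> < 1"
      using abs_Re_le_cmod order.strict_trans1 by blast
    then show ?thesis
      by (auto simp: complex_nonpos_Reals_iff)
  qed
  let ?f = "\<lambda>u::complex. Ln (1 + of_real v * u)"
  have "?f holomorphic_on cball 0 \<rho>"
    by (intro holomorphic_intros) (use nz in auto)
  then have "((\<lambda>u. ?f u / (u - 0)) has_contour_integral 2 * of_real pi * \<i> * ?f 0) (circlepath 0 \<rho>)"
    using assms(1) by (intro Cauchy_integral_circlepath holomorphic_on_imp_continuous_on)
      (auto intro: holomorphic_on_subset[of _ "cball 0 \<rho>"])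
  then have "((\<lambda>t. ?f (0 + of_real \<rho> * cis t) / (0 + of_real \<rho> * cis t - 0) * of_real \<rho> * \<i> * cis t) has_integral 0) {0..2 * pi}"
    unfolding circlepath_def by (subst (asm) has_contour_integral_part_circlepath_iff) auto
  \<comment> \<open>The derivative of the circle cancels the Cauchy kernel up to a factor
    \<open>\<i>\<close>, so the wanted real part of \<open>Ln\<close> appears as the imaginary part
    of the integrand.\<close>
  then have "((\<lambda>t. \<i> * ?f (of_real \<rho> * cis t)) has_integral 0) {0..2 * pi}"
    by (rule has_integral_eq[rotated]) (use assms(1) in \<open>simp add: field_simps\<close>)
  then have "((\<lambda>t. Im (\<i> * ?f (of_real \<rho> * cis t))) has_integral Im 0) {0..2 * pi}"
    by (rule has_integral_Im)
  moreover have "Im (\<i> * ?f (of_real \<rho> * cis t)) = ln (cmod (1 + of_real v * (of_real \<rho> * cis t)))" for t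
  proof -
    have "1 + of_real v * (of_real \<rho> * cis t) \<noteq> 0"
      using nz[of "of_real \<rho> * cis t"] assms(1) by (auto simp: norm_mult)
    then show ?thesis by simp
  qed
  ultimately show ?thesis by simp
qed

lemma one_plus_nonzero:
  fixes z :: complex
  assumes "cmod z < 1"
  shows "1 + z \<noteq> 0"
  using assms by (metis add_eq_0_iff less_irrefl norm_minus_cancel norm_one)

section \<open>Convexity of the logarithmic image\<close>

definition log_bdist :: "(complex ^ 'n) set \<Rightarrow> real ^ 'n \<Rightarrow> real" where
  "log_bdist D x = - ln (bdist D (vexp (cplx x)))"

text \<open>The displacement in logarithmic coordinates when each coordinate \<open>j\<close> is
  multiplied by \<open>1 + v $ j * l\<close>. It does not depend on the starting point.\<close>

definition log_shift :: "real ^ 'n \<Rightarrow> complex \<Rightarrow> real ^ 'n" where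
  "log_shift v l = (\<chi> j. ln (cmod (1 + of_real (v $ j) * l)))"

text \<open>The affine disc \<open>a + l *s b\<close> with \<open>b $ j = v $ j * a $ j\<close> has
  the moduli of \<open>vexp (cplx (x + log_shift v l))\<close>. Membership in \<open>D\<close> and
  \<open>bdist\<close> see only moduli, so the sub-mean value property on this disc carries over to
  logarithmic coordinates.\<close>

lemma log_mean_value:
  fixes D :: "(complex ^ 'n) set"
  assumes R: "Reinhardt D" and P: "plurisubharmonic_on D (\<lambda>z. - ln (bdist D z))"
    and x: "x \<in> log_image D" and "\<rho> > 0" and small: "\<And>j. \<rho> * \<bar>v $ j\<bar> < 1"
    and sub: "\<And>l. cmod l \<le> \<rho> \<Longrightarrow> x + log_shift v l \<in> log_image D"
  shows "set_integrable lborel {0..2 * pi} (\<lambda>t. log_bdist D (x + log_shift v (of_real \<rho> * cis t)))"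
    and "2 * pi * log_bdist D x \<le>
           (LINT t:{0..2 * pi}|lborel. log_bdist D (x + log_shift v (of_real \<rho> * cis t)))"
proof -
  define a where "a = vexp (cplx x)"
  define b where "b = (\<chi> j. of_real (v $ j) * a $ j)"
  have mod_eq: "cmod ((a + l *s b) $ j) = cmod (vexp (cplx (x + log_shift v l)) $ j)"
    if "cmod l \<le> \<rho>" for l j
  proof -
    have "cmod (of_real (v $ j) * l) \<le> \<bar>v $ j\<bar> * \<rho>"
      using that by (simp add: norm_mult mult_left_mono)
    also have "\<dots> < 1" using small[of j] by (simp add: mult.commute)
    finally have "cmod (of_real (v $ j) * l) < 1" .
    then have "1 + of_real (v $ j) * l \<noteq> 0"
      by (rule one_plus_nonzero)
    moreover have "(a + l *s b) $ j = exp (of_real (x $ j)) * (1 + of_real (v $ j) * l)"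
      by (simp add: a_def b_def algebra_simps)
    ultimately show ?thesis
      by (simp add: norm_mult log_shift_def exp_add)
  qed
  have inD: "a + l *s b \<in> D" and bd: "- ln (bdist D (a + l *s b)) = log_bdist D (x + log_shift v l)"
    if "cmod l \<le> \<rho>" for l
    using Reinhardt_cong[OF R mod_eq[OF that]] bdist_cong[OF R mod_eq[OF that]] sub[OF that]
    by (auto simp: log_image_def log_bdist_def)
  have "a \<in> D" using x by (simp add: a_def log_image_def)
  then have "subharmonic_on {l. a + l *s b \<in> D} (\<lambda>l. - ln (bdist D (a + l *s b)))"
    using P by (simp add: plurisubharmonic_on_def)
  moreover have "cball 0 \<rho> \<subseteq> {l. a + l *s b \<in> D}"
    using inD by auto
  ultimately have *: "set_integrable lborel {0..2 * pi} (\<lambda>t. - ln (bdist D (a + (0 + of_real \<rho> * cis t) *s b)))"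
    "- ln (bdist D (a + 0 *s b)) \<le> 1 / (2 * pi) *
       (LINT t:{0..2 * pi}|lborel. - ln (bdist D (a + (0 + of_real \<rho> * cis t) *s b)))"
    using \<open>\<rho> > 0\<close> unfolding subharmonic_on_def by blast+
  have eq: "- ln (bdist D (a + (0 + of_real \<rho> * cis t) *s b)) = log_bdist D (x + log_shift v (of_real \<rho> * cis t))" for t
    using bd[of "of_real \<rho> * cis t"] \<open>\<rho> > 0\<close> by (simp add: norm_mult)
  show "set_integrable lborel {0..2 * pi} (\<lambda>t. log_bdist D (x + log_shift v (of_real \<rho> * cis t)))"
    using *(1) unfolding eq .
  have "log_bdist D x = - ln (bdist D (a + 0 *s b))"
    by (simp add: log_bdist_def a_def)
  then show "2 * pi * log_bdist D x \<le>
           (LINT t:{0..2 * pi}|lborel. log_bdist D (x + log_shift v (of_real \<rho> * cis t)))"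
    using *(2) unfolding eq by (simp add: field_simps)
qed

text \<open>Each component is the real part of \<open>Ln (1 + z) - z\<close> with
  \<open>cmod z \<le> 1 / 2\<close>, hence at most twice the square of \<open>cmod z\<close>; the
  squares of the components of \<open>v\<close> then add up to its squared norm.\<close>

lemma log_shift_approx:
  assumes "cmod l \<le> \<rho>" "\<rho> * norm v \<le> 1 / 2"
  shows "norm (log_shift v l - Re l *\<^sub>R v) \<le> 2 * \<rho>\<^sup>2 * (norm v)\<^sup>2"
proof -
  have "0 \<le> \<rho>" using assms(1) norm_ge_zero order_trans by blast
  have "\<bar>(log_shift v l - Re l *\<^sub>R v) $ j\<bar> \<le> 2 * \<rho>\<^sup>2 * (v $ j)\<^sup>2" for j
  proof -
    define z where "z = of_real (v $ j) * l"
    have zr: "cmod z \<le> \<rho> * \<bar>v $ j\<bar>"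
      using assms(1) by (simp add: z_def norm_mult mult_left_mono mult.commute[of \<rho>])
    also have "\<dots> \<le> \<rho> * norm v"
      using component_le_norm_cart[of v j] \<open>0 \<le> \<rho>\<close> by (intro mult_left_mono)
    finally have half: "cmod z \<le> 1 / 2" using assms(2) by linarith
    then have "1 + z \<noteq> 0"
      by (intro one_plus_nonzero) linarith
    have "(log_shift v l - Re l *\<^sub>R v) $ j = Re (Ln (1 + z) - z)"
      using \<open>1 + z \<noteq> 0\<close> by (simp add: log_shift_def z_def)
    also have "\<bar>\<dots>\<bar> \<le> norm (Ln (1 + z) - z)" by (rule abs_Re_le_cmod)
    also have "\<dots> \<le> (cmod z)\<^sup>2 / (1 - cmod z)"
      using half by (intro Ln_approx_linear) auto
    also have "\<dots> \<le> (cmod z)\<^sup>2 / (1 / 2)"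
      using half by (intro divide_left_mono) auto
    also have "\<dots> \<le> 2 * (\<rho> * \<bar>v $ j\<bar>)\<^sup>2"
      using zr by (simp add: power_mono)
    finally show ?thesis by (simp add: power_mult_distrib)
  qed
  then have "norm (log_shift v l - Re l *\<^sub>R v) \<le> (\<Sum>j\<in>UNIV. 2 * \<rho>\<^sup>2 * (v $ j)\<^sup>2)"
    by (intro order_trans[OF norm_le_l1_cart] sum_mono)
  also have "\<dots> = 2 * \<rho>\<^sup>2 * (norm v)\<^sup>2"
    unfolding power2_norm_eq_inner by (simp add: inner_vec_def sum_distrib_left power2_eq_square)
  finally show ?thesis .
qed

lemma has_integral_cos_period: "(cos has_integral 0) {0..2 * pi}"
proof -
  have "(sin has_vector_derivative cos t) (at t within {0..2 * pi})" for t
    unfolding has_real_derivative_iff_has_vector_derivative[symmetric]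
    by (auto intro!: derivative_eq_intros)
  then show ?thesis
    using fundamental_theorem_of_calculus[of 0 "2 * pi" sin cos] by simp
qed

lemma has_integral_cos_square_period: "((\<lambda>t. (cos t)\<^sup>2) has_integral pi) {0..2 * pi}"
proof -
  have "((\<lambda>t. (t + sin t * cos t) / 2) has_vector_derivative (cos t)\<^sup>2) (at t within {0..2 * pi})" for t
    unfolding has_real_derivative_iff_has_vector_derivative[symmetric]
    by (auto intro!: derivative_eq_intros simp: sin_squared_eq power2_eq_square[symmetric])
  then show ?thesis
    using fundamental_theorem_of_calculus[of 0 "2 * pi" "\<lambda>t. (t + sin t * cos t) / 2" "\<lambda>t. (cos t)\<^sup>2"]
    by simp
qed

text \<open>The logarithms and the linear term each have mean zero over the circle. So the
  second-order deviation from linear motion averages to exactly zero in every fixed direction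
  \<open>w\<close>.\<close>

lemma has_integral_inner_log_shift:
  assumes "\<rho> > 0" "\<And>j. \<rho> * \<bar>v $ j\<bar> < 1"
  shows "((\<lambda>t. w \<bullet> (log_shift v (of_real \<rho> * cis t) - (\<rho> * cos t) *\<^sub>R v)) has_integral 0) {0..2 * pi}"
proof -
  have "((\<lambda>t. \<Sum>j\<in>UNIV. w $ j * (ln (cmod (1 + of_real (v $ j) * (of_real \<rho> * cis t))) - (\<rho> * v $ j) * cos t))
      has_integral (\<Sum>j\<in>(UNIV::'a set). w $ j * (0 - (\<rho> * v $ j) * 0))) {0..2 * pi}"
    by (intro has_integral_sum has_integral_mult_right has_integral_diff
        integral_ln_cmod_circle has_integral_cos_period assms) simp
  then show ?thesis
    by (simp add: inner_vec_def log_shift_def mult_ac)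
qed

lemma continuous_on_log_bdist:
  assumes "open D" "frontier D \<noteq> {}"
  shows "continuous_on (log_image D) (log_bdist D)"
proof -
  have "bdist D (vexp (cplx x)) \<noteq> 0" if "x \<in> log_image D" for x
    using bdist_pos[OF assms(1) _ assms(2)] that by (force simp: log_image_def)
  then show ?thesis
    unfolding log_bdist_def
    by (intro continuous_intros continuous_on_compose2[OF continuous_on_bdist continuous_on_vexp_cplx]) auto
qed

text \<open>A viscosity argument: if \<open>- ln (bdist D)\<close> were larger inside the segment, then the function \<open>T\<close>,
  strictly convexified along the segment and penalised transversally, would have an interior maximum.
  Averaging over a small circle there gains \<open>\<epsilon> \<rho>\<^sup>2 / 2\<close>, while the transversal
  displacement has mean \<open>0\<close> and costs only \<open>O(\<rho>\<^sup>4)\<close>.\<close>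

lemma log_max_principle:
  fixes D :: "(complex ^ 'n) set"
  assumes R: "Reinhardt D" and P: "plurisubharmonic_on D (\<lambda>z. - ln (bdist D z))"
    and F: "frontier D \<noteq> {}"
    and seg: "closed_segment a b \<subseteq> log_image D"
    and x1: "x1 \<in> closed_segment a b"
  shows "log_bdist D x1 \<le> max (log_bdist D a) (log_bdist D b)"
proof (rule ccontr)
  let ?G = "log_image D" and ?\<phi> = "log_bdist D"
  define M where "M = max (?\<phi> a) (?\<phi> b)"
  define v where "v = b - a"
  \<comment> \<open>The excess is split in three: one share pays for the convexifying term, one for
    continuity at the endpoints, and one remains for the contradiction.\<close>
  define \<epsilon> where "\<epsilon> = (?\<phi> x1 - M) / 3"
  assume "\<not> ?\<phi> x1 \<le> max (?\<phi> a) (?\<phi> b)"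
  then have \<epsilon>: "\<epsilon> > 0" "?\<phi> x1 = M + 3 * \<epsilon>" by (auto simp: \<epsilon>_def M_def field_simps)
  have seg_iff: "x \<in> closed_segment a b \<longleftrightarrow> (\<exists>t. 0 \<le> t \<and> t \<le> 1 \<and> x = a + t *\<^sub>R v)" for x
    by (force simp: in_segment v_def algebra_simps)
  obtain t1 where t1: "0 \<le> t1" "t1 \<le> 1" "x1 = a + t1 *\<^sub>R v" using x1 seg_iff by blast
  have oG: "open ?G" and cont: "continuous_on ?G ?\<phi>"
    using open_log_image[OF Reinhardt_open[OF R]] continuous_on_log_bdist[OF Reinhardt_open[OF R] F] by auto
  obtain \<tau>0 where \<tau>0: "\<tau>0 > 0" "(\<Union>x\<in>closed_segment a b. cball x \<tau>0) \<subseteq> ?G"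
    using compact_subset_open_imp_cball_epsilon_subset[OF _ oG seg] by (metis compact_segment)
  have near: "\<exists>d>0. \<forall>w. norm w < d \<longrightarrow> ?\<phi> (p + w) < ?\<phi> p + \<epsilon>" if "p \<in> closed_segment a b" for p
  proof -
    have "isCont ?\<phi> p"
      using cont oG seg that by (auto simp: continuous_on_eq_continuous_at)
    then obtain d where d: "d > 0" "\<And>x. dist x p < d \<Longrightarrow> dist (?\<phi> x) (?\<phi> p) < \<epsilon>"
      using \<epsilon>(1) unfolding continuous_at_eps_delta by (metis)
    have "?\<phi> (p + w) < ?\<phi> p + \<epsilon>" if "norm w < d" for w
      using d(2)[of "p + w"] that by (simp add: dist_norm)
    with d(1) show ?thesis by blast
  qed
  obtain \<tau>1 where \<tau>1: "\<tau>1 > 0" "\<And>w. norm w < \<tau>1 \<Longrightarrow> ?\<phi> (a + w) < ?\<phi> a + \<epsilon>"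
    using near[of a] by auto
  obtain \<tau>2 where \<tau>2: "\<tau>2 > 0" "\<And>w. norm w < \<tau>2 \<Longrightarrow> ?\<phi> (b + w) < ?\<phi> b + \<epsilon>"
    using near[of b] by auto
  define \<tau> where "\<tau> = Min {\<tau>0, \<tau>1 / 2, \<tau>2 / 2}"
  have \<tau>: "\<tau> > 0" "\<tau> \<le> \<tau>0" "\<tau> < \<tau>1" "\<tau> < \<tau>2"
    using \<tau>0(1) \<tau>1(1) \<tau>2(1) by (auto simp: \<tau>_def min_def)
  \<comment> \<open>Position along the segment and displacement are independent parameters. The
    displacement need not be orthogonal to \<open>v\<close>, since the penalty in \<open>T\<close>
    is read off the parameter and not off the point.\<close>
  define S where "S = {0..1::real} \<times> cball (0::real ^ 'n) \<tau>"
  define pt where "pt = (\<lambda>(t, w). a + t *\<^sub>R v + w)"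
  have ptG: "pt s \<in> ?G" if "s \<in> S" for s
  proof -
    obtain t w where s: "s = (t, w)" by fastforce
    then have "0 \<le> t" "t \<le> 1" "norm w \<le> \<tau>"
      using that by (simp_all add: S_def)
    then have "pt s \<in> cball (a + t *\<^sub>R v) \<tau>0" "a + t *\<^sub>R v \<in> closed_segment a b"
      using \<tau>(2) seg_iff by (auto simp: s pt_def dist_norm)
    then show ?thesis using \<tau>0(2) by blast
  qed
  have S: "compact S" "S \<noteq> {}"
    using \<tau>(1) by (auto simp: S_def intro: compact_Times)
  have cont_pt: "continuous_on S (\<lambda>s. ?\<phi> (pt s))"
  proof (rule continuous_on_compose2[OF cont])
    show "continuous_on S pt"
      unfolding pt_def case_prod_beta by (intro continuous_intros)
  qed (use ptG in blast)
  obtain B where B: "\<And>s. s \<in> S \<Longrightarrow> ?\<phi> (pt s) \<le> B"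
    using continuous_attains_sup[OF S cont_pt] by blast
  \<comment> \<open>Large enough that for displacements of norm \<tau> the penalty pushes
    \<open>T\<close> below \<open>?\<phi> x1\<close>, so that no maximum lies there.\<close>
  define K where "K = (\<bar>B - ?\<phi> x1\<bar> + \<epsilon> + 1) / \<tau>\<^sup>2"
  have K: "K \<ge> 0" "K * \<tau>\<^sup>2 = \<bar>B - ?\<phi> x1\<bar> + \<epsilon> + 1"
    using \<epsilon>(1) \<tau>(1) by (auto simp: K_def)
  define T where "T = (\<lambda>s. ?\<phi> (pt s) + \<epsilon> * (fst s)\<^sup>2 - K * (snd s \<bullet> snd s))"
  have "continuous_on S T"
    unfolding T_def by (intro continuous_intros cont_pt)
  then obtain s0 where s0: "s0 \<in> S" "\<And>s. s \<in> S \<Longrightarrow> T s \<le> T s0"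
    using continuous_attains_sup[OF S] by blast
  obtain t0 w0 where s0_eq: "s0 = (t0, w0)" by force
  have tw0: "0 \<le> t0" "t0 \<le> 1" "norm w0 \<le> \<tau>"
    using s0(1) by (auto simp: s0_eq S_def)
  have "?\<phi> x1 \<le> T (t1, 0)"
    using t1 \<epsilon>(1) by (simp add: T_def pt_def)
  also have "T (t1, 0) \<le> T s0"
    using t1 \<tau>(1) by (intro s0(2)) (auto simp: S_def)
  finally have big: "?\<phi> x1 \<le> ?\<phi> (a + t0 *\<^sub>R v + w0) + \<epsilon> * t0\<^sup>2 - K * (w0 \<bullet> w0)"
    by (simp add: T_def s0_eq pt_def)
  have "\<epsilon> * t0\<^sup>2 \<le> \<epsilon>"
    using tw0 \<epsilon>(1) by (simp add: mult_left_le power_le_one)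
  have "norm w0 \<noteq> \<tau>"
  proof
    assume "norm w0 = \<tau>"
    then have "K * (w0 \<bullet> w0) = \<bar>B - ?\<phi> x1\<bar> + \<epsilon> + 1"
      using K(2) by (simp add: power2_norm_eq_inner[symmetric])
    moreover have "?\<phi> (a + t0 *\<^sub>R v + w0) \<le> B"
      using B[OF s0(1)] by (simp add: s0_eq pt_def)
    ultimately show False using big \<open>\<epsilon> * t0\<^sup>2 \<le> \<epsilon>\<close> by linarith
  qed
  with tw0 have w0: "norm w0 < \<tau>" by simp
  have Kw: "K * (w0 \<bullet> w0) \<ge> 0" using K(1) by simp
  have "t0 \<noteq> 0"
  proof
    assume "t0 = 0"
    then have "?\<phi> x1 \<le> ?\<phi> (a + w0)" using big Kw by simp
    also have "\<dots> < ?\<phi> a + \<epsilon>" using \<tau>1(2) w0 \<tau>(3) by simp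
    also have "?\<phi> a \<le> M" by (simp add: M_def)
    finally show False using \<epsilon> by simp
  qed
  have "t0 \<noteq> 1"
  proof
    assume "t0 = 1"
    then have "?\<phi> x1 \<le> ?\<phi> (b + w0) + \<epsilon>" using big Kw by (simp add: v_def)
    also have "?\<phi> (b + w0) < ?\<phi> b + \<epsilon>" using \<tau>2(2) w0 \<tau>(4) by simp
    also have "?\<phi> b \<le> M" by (simp add: M_def)
    finally show False using \<epsilon> by simp
  qed
  with \<open>t0 \<noteq> 0\<close> tw0 have t0: "0 < t0" "t0 < 1" by auto
  define H where "H = 2 * (norm v)\<^sup>2"
  have "H \<ge> 0" by (simp add: H_def)
  \<comment> \<open>In order, the bounds give \<open>\<rho>\<^sup>2 \<le> \<rho>\<close>, keep
    \<open>t0 + Re l\<close> in the unit interval, permit \<open>log_shift_approx\<close>, keep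
    \<open>w0 + h l\<close> in the \<tau>-ball, and make the penalty small against the gain from
    convexification.\<close>
  define \<rho> where "\<rho> = Min {1, t0, 1 - t0, 1 / (2 * (norm v + 1)), (\<tau> - norm w0) / (H + 1), \<epsilon> / (4 * (K * H\<^sup>2 + 1))}"
  have "norm v + 1 > 0" "H + 1 > 0" "K * H\<^sup>2 + 1 > 0"
    using \<open>H \<ge> 0\<close> K(1) by (simp_all add: add_nonneg_pos)
  then have \<rho>: "\<rho> > 0" "\<rho> \<le> 1" "\<rho> \<le> t0" "\<rho> \<le> 1 - t0" 
    and "\<rho> \<le> 1 / (2 * (norm v + 1))" "\<rho> \<le> (\<tau> - norm w0) / (H + 1)" "\<rho> \<le> \<epsilon> / (4 * (K * H\<^sup>2 + 1))"
    using t0 w0 \<epsilon>(1) by (auto simp: \<rho>_def)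
  with \<open>norm v + 1 > 0\<close> \<open>H + 1 > 0\<close> \<open>K * H\<^sup>2 + 1 > 0\<close>
  have "\<rho> * (norm v + 1) \<le> 1 / 2" and \<rho>w: "\<rho> * (H + 1) \<le> \<tau> - norm w0" and \<rho>\<epsilon>: "\<rho> * (K * H\<^sup>2 + 1) \<le> \<epsilon> / 4"
    by (simp_all add: field_simps)
  then have \<rho>v: "\<rho> * norm v < 1 / 2" using \<rho>(1) by (simp add: algebra_simps)
  have "\<rho>\<^sup>2 \<le> \<rho>" using \<rho>(1,2) by (simp add: power2_eq_square mult_left_le)
  define h where "h = (\<lambda>l. log_shift v l - Re l *\<^sub>R v)"
  define x0 where "x0 = a + t0 *\<^sub>R v + w0"
  have x0G: "x0 \<in> ?G" using ptG[OF s0(1)] by (simp add: s0_eq pt_def x0_def)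
  have h_le: "norm (h l) \<le> \<rho>\<^sup>2 * H" if "cmod l \<le> \<rho>" for l
    using log_shift_approx[OF that, of v] \<rho>v by (simp add: h_def H_def mult_ac)
  have inS: "(t0 + Re l, w0 + h l) \<in> S" if "cmod l \<le> \<rho>" for l
  proof -
    have "\<bar>Re l\<bar> \<le> \<rho>" using that abs_Re_le_cmod order_trans by blast
    moreover have "norm (w0 + h l) \<le> norm w0 + \<rho>\<^sup>2 * H"
      using norm_triangle_ineq h_le[OF that] by (meson add_left_mono order_trans)
    moreover have "\<rho>\<^sup>2 * H \<le> \<rho> * (H + 1)"
      using \<open>\<rho>\<^sup>2 \<le> \<rho>\<close> \<open>H \<ge> 0\<close> \<rho>(1) by (intro mult_mono) auto
    ultimately show ?thesis using \<rho> \<rho>w by (auto simp: S_def)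
  qed
  have pt_eq: "pt (t0 + Re l, w0 + h l) = x0 + log_shift v l" for l
    by (simp add: pt_def x0_def h_def algebra_simps)
  \<comment> \<open>This expands \<open>T \<le> T s0\<close> at the shifted parameters. The terms
    linear in \<open>Re l\<close> and \<open>h l\<close> are kept exactly because they integrate to
    zero; only the square of \<open>h l\<close> is estimated.\<close>
  have upper: "?\<phi> (x0 + log_shift v l) \<le> ?\<phi> x0 + K * (\<rho>\<^sup>2 * H)\<^sup>2 - 2 * \<epsilon> * t0 * Re l - \<epsilon> * (Re l)\<^sup>2 + 2 * K * (w0 \<bullet> h l)"
    if "cmod l \<le> \<rho>" for l
  proof -
    have "T (t0 + Re l, w0 + h l) \<le> T s0" by (rule s0(2)[OF inS[OF that]])
    moreover have "T s0 = ?\<phi> x0 + \<epsilon> * t0\<^sup>2 - K * (w0 \<bullet> w0)"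
      by (simp add: T_def s0_eq pt_def x0_def)
    moreover have "T (t0 + Re l, w0 + h l) = ?\<phi> (x0 + log_shift v l) + \<epsilon> * (t0 + Re l)\<^sup>2 - K * ((w0 + h l) \<bullet> (w0 + h l))"
      by (simp add: T_def pt_eq)
    moreover have "K * (h l \<bullet> h l) \<le> K * (\<rho>\<^sup>2 * H)\<^sup>2"
      using h_le[OF that] K(1) by (intro mult_left_mono) (simp_all add: power2_norm_eq_inner[symmetric] power_mono)
    ultimately show ?thesis
      by (simp add: algebra_simps power2_eq_square inner_commute)
  qed
  have small: "\<rho> * \<bar>v $ j\<bar> < 1" for j
  proof -
    have "\<rho> * \<bar>v $ j\<bar> \<le> \<rho> * norm v"
      using component_le_norm_cart[of v j] \<rho>(1) by (intro mult_left_mono) auto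
    then show ?thesis using \<rho>v by linarith
  qed
  have sub: "x0 + log_shift v l \<in> ?G" if "cmod l \<le> \<rho>" for l
    using ptG[OF inS[OF that]] by (simp add: pt_eq)
  let ?\<psi> = "\<lambda>t. ?\<phi> (x0 + log_shift v (of_real \<rho> * cis t))"
  note mv = log_mean_value[OF R P x0G \<rho>(1) small sub]
  have int1: "(?\<psi> has_integral (LINT t:{0..2 * pi}|lborel. ?\<psi> t)) {0..2 * pi}"
    using set_borel_integral_eq_integral[OF mv(1)] by (simp add: has_integral_integral)
  have int2: "((\<lambda>t. ?\<phi> x0 + K * (\<rho>\<^sup>2 * H)\<^sup>2 - 2 * \<epsilon> * t0 * \<rho> * cos t - \<epsilon> * \<rho>\<^sup>2 * (cos t)\<^sup>2 + 2 * K * (w0 \<bullet> h (of_real \<rho> * cis t)))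
    has_integral ((2 * pi) * (?\<phi> x0 + K * (\<rho>\<^sup>2 * H)\<^sup>2) - 2 * \<epsilon> * t0 * \<rho> * 0 - \<epsilon> * \<rho>\<^sup>2 * pi + 2 * K * 0)) {0..2 * pi}"
    using has_integral_const_real[of "?\<phi> x0 + K * (\<rho>\<^sup>2 * H)\<^sup>2" 0 "2 * pi"]
      has_integral_inner_log_shift[OF \<rho>(1) small]
    by (intro has_integral_add has_integral_diff has_integral_mult_right
        has_integral_cos_period has_integral_cos_square_period) (simp_all add: h_def)
  have "(LINT t:{0..2 * pi}|lborel. ?\<psi> t) \<le>
     (2 * pi) * (?\<phi> x0 + K * (\<rho>\<^sup>2 * H)\<^sup>2) - 2 * \<epsilon> * t0 * \<rho> * 0 - \<epsilon> * \<rho>\<^sup>2 * pi + 2 * K * 0"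
  proof (rule has_integral_le[OF int1 int2])
    fix t
    show "?\<psi> t \<le> ?\<phi> x0 + K * (\<rho>\<^sup>2 * H)\<^sup>2 - 2 * \<epsilon> * t0 * \<rho> * cos t - \<epsilon> * \<rho>\<^sup>2 * (cos t)\<^sup>2 + 2 * K * (w0 \<bullet> h (of_real \<rho> * cis t))"
      using upper[of "of_real \<rho> * cis t"] \<rho>(1) by (simp add: norm_mult power_mult_distrib mult_ac)
  qed
  with mv(2) have "2 * pi * ?\<phi> x0 \<le>
     (2 * pi) * (?\<phi> x0 + K * (\<rho>\<^sup>2 * H)\<^sup>2) - 2 * \<epsilon> * t0 * \<rho> * 0 - \<epsilon> * \<rho>\<^sup>2 * pi + 2 * K * 0"
    by (rule order_trans)
  \<comment> \<open>What is left compares a second-order gain with a fourth-order penalty; dividing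
    by \<open>\<rho>\<^sup>2\<close>, the choice of \<rho> yields
    \<open>\<epsilon> \<le> \<epsilon> / 2\<close>.\<close>
  then have "0 \<le> pi * (2 * (K * (\<rho>\<^sup>2 * H)\<^sup>2) - \<epsilon> * \<rho>\<^sup>2)"
    by (simp add: algebra_simps)
  then have "\<epsilon> * \<rho>\<^sup>2 \<le> 2 * (K * (\<rho>\<^sup>2 * H)\<^sup>2)"
    using pi_gt_zero by (auto simp: zero_le_mult_iff)
  then have "\<epsilon> * \<rho>\<^sup>2 \<le> 2 * K * (\<rho>\<^sup>2 * H)\<^sup>2" by simp
  also have "\<dots> = (2 * (\<rho>\<^sup>2 * (K * H\<^sup>2))) * \<rho>\<^sup>2" by (simp add: power2_eq_square)
  finally have "\<epsilon> \<le> 2 * (\<rho>\<^sup>2 * (K * H\<^sup>2))" 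
    by (rule mult_right_le_imp_le) (use \<rho>(1) in simp)
  also have "\<rho>\<^sup>2 * (K * H\<^sup>2) \<le> \<rho> * (K * H\<^sup>2 + 1)"
    using \<open>\<rho>\<^sup>2 \<le> \<rho>\<close> K(1) \<rho>(1) by (intro mult_mono) auto
  finally show False using \<rho>\<epsilon> \<epsilon>(1) by linarith
qed

section \<open>From the maximum principle to convexity\<close>

lemma nonzero_perturbation:
  fixes z :: "complex ^ 'n"
  assumes "\<kappa> > 0"
  obtains z' where "\<And>j. \<kappa> \<le> cmod (z' $ j)" "norm (z' - z) \<le> 2 * \<kappa> * real CARD('n)"
proof
  \<comment> \<open>A coordinate of modulus below \<kappa>, moved by \<open>2 * \<kappa>\<close>,
    ends with modulus above \<kappa>.\<close>
  let ?z' = "\<chi> j. if cmod (z $ j) < \<kappa> then z $ j + of_real (2 * \<kappa>) else z $ j"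
  show "\<kappa> \<le> cmod (?z' $ j)" for j
    using norm_diff_ineq[of "of_real (2 * \<kappa>)" "z $ j"] assms by (auto simp: add.commute)
  have "norm (?z' - z) \<le> (\<Sum>j\<in>UNIV. cmod ((?z' - z) $ j))"
    by (rule norm_cvec_le_sum)
  also have "\<dots> \<le> (\<Sum>j\<in>(UNIV :: 'n set). 2 * \<kappa>)"
    using assms by (intro sum_mono) auto
  finally show "norm (?z' - z) \<le> 2 * \<kappa> * real CARD('n)" by (simp add: mult.commute)
qed

text \<open>A continuity method: \<open>r\<close> moves from \<open>p\<close> to \<open>q\<close>,
  and the maximum principle bounds the boundary distance from below on every segment from
  \<open>a\<close> to \<open>r\<close> inside the image. The bound is uniform in \<open>r\<close>,
  so the segments cannot start to leave the image.\<close>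

lemma log_segment_triangle:
  fixes D :: "(complex ^ 'n) set"
  assumes R: "Reinhardt D" and P: "plurisubharmonic_on D (\<lambda>z. - ln (bdist D z))"
    and F: "frontier D \<noteq> {}"
    and ap: "closed_segment a p \<subseteq> log_image D" and pq: "closed_segment p q \<subseteq> log_image D"
  shows "closed_segment a q \<subseteq> log_image D"
proof -
  let ?G = "log_image D"
  let ?E = "\<lambda>x. vexp (cplx x)"
  \<comment> \<open>All endpoints of the moving segments lie in this compact set, so the maximum of
    \<open>log_bdist D\<close> over it controls every segment.\<close>
  define A where "A = insert a (closed_segment p q)"
  have A: "compact A" "A \<noteq> {}" "A \<subseteq> ?G"
    using ap pq by (auto simp: A_def)
  obtain x0 where x0: "x0 \<in> A" "\<And>x. x \<in> A \<Longrightarrow> log_bdist D x \<le> log_bdist D x0"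
    using continuous_attains_sup[OF A(1,2) continuous_on_subset[OF continuous_on_log_bdist[OF Reinhardt_open[OF R] F] A(3)]]
    by blast
  define m where "m = bdist D (?E x0)"
  have pos: "bdist D (?E x) > 0" if "x \<in> ?G" for x
    using bdist_pos[OF Reinhardt_open[OF R] _ F] that by (simp add: log_image_def)
  have m: "m > 0" using pos x0(1) A(3) by (auto simp: m_def)
  have m_le: "m \<le> bdist D (?E x)" if "closed_segment a r \<subseteq> ?G" "r \<in> closed_segment p q" "x \<in> closed_segment a r" for r x
  proof -
    have "log_bdist D x \<le> max (log_bdist D a) (log_bdist D r)"
      by (rule log_max_principle[OF R P F that(1,3)])
    also have "\<dots> \<le> log_bdist D x0"
      using x0(2) that(2) by (simp add: A_def)
    finally have "ln m \<le> ln (bdist D (?E x))" by (simp add: log_bdist_def m_def)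
    then show ?thesis using m pos that(1,3) by (simp add: subset_iff)
  qed
  \<comment> \<open>The hull bounds this set, passing to \<open>closure D\<close> makes it closed,
    and the lower bound \<open>m\<close> keeps it off the frontier. Being compact in the open image,
    it has a uniform margin \<eta>.\<close>
  define C where "C = convex hull {a, p, q} \<inter> {x. ?E x \<in> closure D} \<inter> {x. m \<le> bdist D (?E x)}"
  have "closed {x. ?E x \<in> closure D}"
    using closed_vimage[OF closed_closure continuous_on_vexp_cplx, of D] by (simp add: vimage_def)
  moreover have "closed {x. m \<le> bdist D (?E x)}"
    by (intro closed_Collect_le continuous_intros
        continuous_on_compose2[OF continuous_on_bdist[of UNIV] continuous_on_vexp_cplx]) auto
  ultimately have "compact C"
    unfolding C_def by (intro compact_Int_closed finite_imp_compact_convex_hull) auto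
  have "C \<subseteq> ?G"
  proof
    fix x assume "x \<in> C"
    then have x: "?E x \<in> closure D" "m \<le> infdist (?E x) (frontier D)" by (auto simp: C_def bdist_def)
    then have "?E x \<notin> frontier D" using m by auto
    then show "x \<in> ?G"
      using x(1) interior_subset by (auto simp: frontier_def log_image_def)
  qed
  then obtain \<eta> where \<eta>: "\<eta> > 0" "(\<Union>x\<in>C. ball x \<eta>) \<subseteq> ?G"
    using compact_subset_open_imp_ball_epsilon_subset[OF \<open>compact C\<close> open_log_image[OF Reinhardt_open[OF R]]]
    by metis
  have hull: "closed_segment p q \<subseteq> convex hull {a, p, q}"
    by (metis hull_mono segment_convex_hull subset_insertI)
  have seg_hull: "closed_segment a r \<subseteq> convex hull {a, p, q}" if "r \<in> closed_segment p q" for r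
    using hull that by (intro closed_segment_subset) (auto simp: hull_inc)
  show ?thesis
  proof (rule connected_induction_simple[of "closed_segment p q" p q "\<lambda>r. closed_segment a r \<subseteq> ?G"])
    fix c assume c: "c \<in> closed_segment p q"
    let ?T = "closed_segment p q \<inter> ball c (\<eta> / 2)"
    \<comment> \<open>Points with the same parameter on the two segments differ by less than \<eta>,
      so the property is locally constant in \<open>r\<close>.\<close>
    have "closed_segment a y \<subseteq> ?G" if "x \<in> ?T" "y \<in> ?T" "closed_segment a x \<subseteq> ?G" for x y
    proof
      fix w assume "w \<in> closed_segment a y"
      then obtain t where t: "0 \<le> t" "t \<le> 1" "w = (1 - t) *\<^sub>R a + t *\<^sub>R y"
        by (auto simp: in_segment)
      define w' where "w' = (1 - t) *\<^sub>R a + t *\<^sub>R x"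
      have w': "w' \<in> closed_segment a x" using t by (auto simp: w'_def in_segment)
      then have "w' \<in> ?G" using that(3) by blast
      then have "?E w' \<in> closure D" by (auto simp: log_image_def closure_subset[THEN subsetD])
      then have "w' \<in> C"
        using m_le[OF that(3) _ w'] that(1) seg_hull w' by (auto simp: C_def)
      have "dist w' w = t * dist x y"
        using t by (simp add: w'_def dist_norm flip: scaleR_diff_right)
      also have "\<dots> \<le> dist x y" using t by (simp add: mult_left_le_one_le)
      also have "\<dots> < \<eta>"
        using that(1,2) dist_triangle_half_r[of c x \<eta> y] by auto
      finally have "w \<in> ball w' \<eta>" by simp
      moreover have "ball w' \<eta> \<subseteq> ?G"
        using \<eta>(2) \<open>w' \<in> C\<close> by (rule UN_subset_iff[THEN iffD1, THEN bspec])
      ultimately show "w \<in> ?G" by (rule subsetD[rotated])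
    qed
    moreover have "openin (top_of_set (closed_segment p q)) ?T"
      by (rule openin_open_Int) simp
    moreover have "c \<in> ?T" using c \<eta>(1) by simp
    ultimately show "\<exists>T. openin (top_of_set (closed_segment p q)) T \<and> c \<in> T \<and>
        (\<forall>x\<in>T. \<forall>y\<in>T. closed_segment a x \<subseteq> ?G \<longrightarrow> closed_segment a y \<subseteq> ?G)"
      by metis
  qed (use ap in auto)
qed

text \<open>With \<open>a\<close> fixed, connectedness of \<open>D\<close> carries the inclusion of
  the segment from \<open>a\<close> to \<open>log_vec z\<close> along from one end to the other. The
  path may cross coordinate hyperplanes, where \<open>log_vec\<close> means nothing; hence an
  induction that tests the inclusion only on the dense set of points without zero
  coordinates.\<close>

lemma convex_log_image:
  fixes D :: "(complex ^ 'n) set"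
  assumes R: "Reinhardt D" and P: "plurisubharmonic_on D (\<lambda>z. - ln (bdist D z))"
    and F: "frontier D \<noteq> {}"
  shows "convex (log_image D)"
  unfolding convex_contains_segment
proof (intro ballI)
  let ?G = "log_image D"
  let ?E = "\<lambda>x. vexp (cplx x)"
  fix a b assume "a \<in> ?G" "b \<in> ?G"
  have oD: "open D" by (rule Reinhardt_open[OF R])
  have "closed_segment a (log_vec (?E b)) \<subseteq> ?G"
  proof (rule connected_induction[of D "\<lambda>z. \<forall>j. z $ j \<noteq> 0" "\<lambda>z. closed_segment a (log_vec z) \<subseteq> ?G" "?E a" "?E b"])
    \<comment> \<open>Density of the points without zero coordinates.\<close>
    fix T z assume "openin (top_of_set D) T" "z \<in> T"
    then have "open T" using oD by (simp add: openin_open_eq)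
    then obtain r where r: "r > 0" "ball z r \<subseteq> T" using \<open>z \<in> T\<close> open_contains_ball by blast
    define \<kappa> where "\<kappa> = r / (4 * real CARD('n))"
    have "\<kappa> > 0" using r by (simp add: \<kappa>_def)
    then obtain z' where z': "\<And>j. \<kappa> \<le> cmod (z' $ j)" "norm (z' - z) \<le> 2 * \<kappa> * real CARD('n)"
      using nonzero_perturbation by blast
    have "2 * \<kappa> * real CARD('n) < r" using r by (simp add: \<kappa>_def)
    with z'(2) have "z' \<in> T" using r(2) by (auto simp: dist_norm norm_minus_commute)
    moreover have "\<forall>j. z' $ j \<noteq> 0" using z'(1) \<open>\<kappa> > 0\<close> by (metis norm_zero not_le)
    ultimately show "\<exists>z'. z' \<in> T \<and> (\<forall>j. z' $ j \<noteq> 0)" by blast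
  next
    fix z assume "z \<in> D"
    then obtain r where r: "r > 0" "ball z r \<subseteq> D" using oD open_contains_ball by blast
    define \<kappa> where "\<kappa> = r / real CARD('n)"
    have "\<kappa> > 0" using r by (simp add: \<kappa>_def)
    \<comment> \<open>The condition confines each modulus to an interval, so in logarithmic
      coordinates it defines a convex set. Two points satisfying it are thus joined by a segment in
      the image, as \<open>log_segment_triangle\<close> demands.\<close>
    have poly: "w \<in> D" if w: "\<And>j. \<bar>cmod (w $ j) - cmod (z $ j)\<bar> < \<kappa>" for w
    proof -
      \<comment> \<open>The moduli of \<open>w\<close> with the phases of \<open>z\<close>: then
        \<open>w' - z\<close> is as small as the differences of the moduli.\<close>
      define w' where "w' = (\<chi> j. if z $ j = 0 then of_real (cmod (w $ j)) else sgn (z $ j) * of_real (cmod (w $ j)))"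
      have "cmod ((w' - z) $ j) < \<kappa>" for j
      proof (cases "z $ j = 0")
        case False
        then have "(w' - z) $ j = sgn (z $ j) * of_real (cmod (w $ j) - cmod (z $ j))"
          by (simp add: w'_def algebra_simps sgn_eq)
        then show ?thesis using w[of j] False by (simp add: norm_mult norm_sgn del: of_real_diff)
      qed (use w[of j] in \<open>simp add: w'_def\<close>)
      then have "(\<Sum>j\<in>UNIV. cmod ((w' - z) $ j)) < (\<Sum>j\<in>(UNIV :: 'n set). \<kappa>)"
        by (intro sum_strict_mono) auto
      then have "norm (w' - z) < r"
        using norm_cvec_le_sum[of "w' - z"] by (simp add: \<kappa>_def)
      then have "w' \<in> D" using r(2) by (auto simp: dist_norm norm_minus_commute)
      moreover have "cmod (w' $ j) = cmod (w $ j)" for j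
        by (simp add: w'_def norm_mult norm_sgn)
      ultimately show "w \<in> D" using Reinhardt_cong[OF R] by blast
    qed
    have "closed_segment a (log_vec y) \<subseteq> ?G"
      if x: "x \<in> ball z \<kappa>" "\<forall>j. x $ j \<noteq> 0" and y: "y \<in> ball z \<kappa>" "\<forall>j. y $ j \<noteq> 0"
        and ax: "closed_segment a (log_vec x) \<subseteq> ?G" for x y
    proof (rule log_segment_triangle[OF R P F ax], rule subsetI)
      fix s assume "s \<in> closed_segment (log_vec x) (log_vec y)"
      then obtain u where u: "0 \<le> u" "u \<le> 1" "s = (1 - u) *\<^sub>R log_vec x + u *\<^sub>R log_vec y"
        by (auto simp: in_segment)
      have "\<bar>exp (s $ j) - cmod (z $ j)\<bar> < \<kappa>" for j
      proof -
        have near: "\<bar>cmod (w $ j) - cmod (z $ j)\<bar> < \<kappa>" if "w \<in> ball z \<kappa>" for w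
        proof -
          have "\<bar>cmod (w $ j) - cmod (z $ j)\<bar> \<le> cmod ((w - z) $ j)"
            using norm_triangle_ineq3 by simp
          also have "\<dots> \<le> norm (w - z)" by (rule Finite_Cartesian_Product.norm_nth_le)
          finally show ?thesis using that by (simp add: dist_norm norm_minus_commute)
        qed
        let ?x = "ln (cmod (x $ j))" and ?y = "ln (cmod (y $ j))"
        have sj: "s $ j = (1 - u) * ?x + u * ?y" by (simp add: u(3))
        have "s $ j \<le> max ?x ?y"
          unfolding sj by (rule convex_bound_le) (use u in auto)
        moreover have "min ?x ?y \<le> s $ j"
          using convex_bound_le[of "-?x" "- min ?x ?y" "- ?y" "1 - u" u] u by (simp add: sj)
        ultimately have "exp (s $ j) \<le> exp (max ?x ?y)" "exp (min ?x ?y) \<le> exp (s $ j)" by simp_all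
        moreover have "exp (max ?x ?y) = max (cmod (x $ j)) (cmod (y $ j))"
          "exp (min ?x ?y) = min (cmod (x $ j)) (cmod (y $ j))"
          using x(2) y(2) by (simp_all add: max_def min_def)
        ultimately have "min (cmod (x $ j)) (cmod (y $ j)) \<le> exp (s $ j)"
          "exp (s $ j) \<le> max (cmod (x $ j)) (cmod (y $ j))" by (simp_all only:)
        then show ?thesis
          using near[OF x(1)] near[OF y(1)] by (auto simp: max_def min_def split: if_splits)
      qed
      then show "s \<in> ?G"
        unfolding log_image_def mem_Collect_eq by (intro poly) simp
    qed
    moreover have "ball z \<kappa> \<subseteq> D"
    proof -
      have "\<kappa> \<le> r" using r by (simp add: \<kappa>_def divide_le_eq mult_le_cancel_left1 Suc_leI)
      then show ?thesis using r(2) by (auto simp: subset_iff)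
    qed
    ultimately show "\<exists>T. openin (top_of_set D) T \<and> z \<in> T \<and>
        (\<forall>x\<in>T. \<forall>y\<in>T. (\<forall>j. x $ j \<noteq> 0) \<and> (\<forall>j. y $ j \<noteq> 0) \<and> closed_segment a (log_vec x) \<subseteq> ?G \<longrightarrow>
           closed_segment a (log_vec y) \<subseteq> ?G)"
      using \<open>\<kappa> > 0\<close> oD by (intro exI[of _ "ball z \<kappa>"]) (auto simp: openin_open_eq)
  qed (use \<open>a \<in> ?G\<close> \<open>b \<in> ?G\<close> Reinhardt_connected[OF R] in \<open>auto simp: log_image_def\<close>)
  then show "closed_segment a b \<subseteq> ?G" by simp
qed

section \<open>Chains of discs\<close>

text \<open>An upper bound on \<open>kobayashi\<close> together with a chain that witnesses it: with
  a real bound and an explicit chain, links are appended without handling infima.\<close>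

definition linked_within :: "(complex ^ 'n) set \<Rightarrow> complex ^ 'n \<Rightarrow> complex ^ 'n \<Rightarrow> real \<Rightarrow> bool" where
  "linked_within D w z a \<longleftrightarrow> (\<exists>(N::nat) c. 1 \<le> N \<and> (\<forall>j\<le>N. c j \<in> D) \<and> c 0 = w \<and> c N = z \<and>
     (\<Sum>j=1..N. lempert D (c (j - 1)) (c j)) \<le> ereal a)"

lemma kobayashi_le: "linked_within D w z a \<Longrightarrow> kobayashi D w z \<le> ereal a"
  unfolding linked_within_def kobayashi_def by (elim exE conjE) (rule Inf_lower2, auto)

lemma linked_within_single:
  assumes "w \<in> D" "z \<in> D" "lempert D w z \<le> ereal a"
  shows "linked_within D w z a"
  unfolding linked_within_def
  by (rule exI[of _ 1], rule exI[of _ "\<lambda>j. if j = 0 then w else z"]) (use assms in auto)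

lemma linked_within_step:
  assumes "linked_within D w u a" "z \<in> D" "lempert D u z \<le> ereal b"
  shows "linked_within D w z (a + b)"
proof -
  obtain N :: nat and c where c: "1 \<le> N" "\<forall>j\<le>N. c j \<in> D" "c 0 = w" "c N = u"
    "(\<Sum>j=1..N. lempert D (c (j - 1)) (c j)) \<le> ereal a"
    using assms(1) unfolding linked_within_def by blast
  let ?c = "c(Suc N := z)"
  have "(\<Sum>j=1..Suc N. lempert D (?c (j - 1)) (?c j)) = (\<Sum>j=1..N. lempert D (c (j - 1)) (c j)) + lempert D u z"
  proof -
    have "(\<Sum>j=1..N. lempert D (?c (j - 1)) (?c j)) = (\<Sum>j=1..N. lempert D (c (j - 1)) (c j))"
      by (intro sum.cong) auto
    then show ?thesis using c(4) by simp
  qed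
  also have "\<dots> \<le> ereal (a + b)"
    using add_mono[OF c(5) assms(3)] by simp
  finally show ?thesis
    unfolding linked_within_def using c assms(2)
    by (intro exI[of _ "Suc N"] exI[of _ ?c]) (auto simp: le_Suc_eq)
qed

lemma linked_within_mono: "linked_within D w z a \<Longrightarrow> a \<le> b \<Longrightarrow> linked_within D w z b"
proof -
  have "x \<le> ereal a \<Longrightarrow> a \<le> b \<Longrightarrow> x \<le> ereal b" for x
    by (erule order_trans) simp
  then show "linked_within D w z a \<Longrightarrow> a \<le> b \<Longrightarrow> linked_within D w z b"
    unfolding linked_within_def by blast
qed

lemma lempert_le:
  assumes "holomorphic_disc D f" "cmod l < 1" "cmod m < 1" "f l = w" "f m = z"
  shows "lempert D w z \<le> ereal (poincare_dist l m)"
  unfolding lempert_def using assms by (intro Inf_lower) auto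

lemma poincare_dist_0 [simp]:
  "poincare_dist 0 m = artanh (cmod m)" "poincare_dist l 0 = artanh (cmod l)"
  by (simp_all add: poincare_dist_def)

text \<open>The affine disc centred at \<open>z\<close> that reaches \<open>w\<close> at parameter
  \<open>1 / 2\<close> stays in the ball of radius \<open>bdist D z\<close>, so the cost is the same
  whatever the scale.\<close>

lemma lempert_ball_le:
  assumes "z \<in> D" "bdist D z > 0" "2 * norm (w - z) \<le> bdist D z"
  shows "lempert D z w \<le> ereal (artanh (1 / 2))" "lempert D w z \<le> ereal (artanh (1 / 2))" "w \<in> D"
proof -
  define f where "f = (\<lambda>l. z + (2 * l) *s (w - z))"
  have norm_smult: "norm (c *s u) = cmod c * norm u" for c and u :: "complex ^ 'a"
    by (simp add: norm_vec_def norm_mult L2_set_right_distrib)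
  have fD: "f l \<in> D" if "cmod l < 1" for l
  proof -
    have "norm (f l - z) = cmod l * (2 * norm (w - z))"
      by (simp add: f_def norm_smult norm_mult del: vector_ssub_ldistrib)
    also have "\<dots> \<le> cmod l * bdist D z" using assms(3) by (intro mult_left_mono) auto
    also have "\<dots> < bdist D z" using that assms(2) by simp
    finally show ?thesis
      using ball_bdist_subset[OF assms(1)] by (auto simp: dist_norm norm_minus_commute)
  qed
  have hol: "holomorphic_disc D f"
    unfolding holomorphic_disc_def
  proof (intro conjI allI)
    show "(\<lambda>l. f l $ j) holomorphic_on ball 0 1" for j
      unfolding f_def by (auto intro!: holomorphic_intros)
  qed (use fD in auto)
  have f: "f 0 = z" "f (1 / 2) = w" by (simp_all add: f_def vec_eq_iff)
  show "lempert D z w \<le> ereal (artanh (1 / 2))"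
    using lempert_le[OF hol _ _ f(1,2)] by (simp add: norm_divide)
  show "lempert D w z \<le> ereal (artanh (1 / 2))"
    using lempert_le[OF hol _ _ f(2,1)] by (simp add: norm_divide)
  show "w \<in> D" using fD[of "1 / 2"] f(2) by (simp add: norm_divide)
qed

section \<open>Discs obtained by exponentiating affine discs\<close>

definition polar :: "real ^ 'n \<Rightarrow> real ^ 'n \<Rightarrow> complex ^ 'n" where
  "polar x \<theta> = vexp (\<chi> j. Complex (x $ j) (\<theta> $ j))"

lemma polar_in_iff: "Reinhardt D \<Longrightarrow> polar x \<theta> \<in> D \<longleftrightarrow> x \<in> log_image D"
  by (simp add: polar_def vexp_in_iff)

lemma polar_log_vec:
  assumes "\<And>j. z $ j \<noteq> 0"
  shows "polar (log_vec z) (\<chi> j. Arg (z $ j)) = z"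
proof -
  have "exp (Complex (ln (cmod (z $ j))) (Arg (z $ j))) = z $ j" for j
    using Arg_eq[OF assms[of j]] assms[of j]
    by (simp add: Complex_eq exp_add mult.commute flip: of_real_exp exp_of_real)
  then show ?thesis by (simp add: polar_def vec_eq_iff)
qed

lemma holomorphic_disc_vexp:
  assumes "Reinhardt D" "\<And>l. cmod l < 1 \<Longrightarrow> (\<chi> j. Re (c $ j + l * v $ j)) \<in> log_image D"
  shows "holomorphic_disc D (\<lambda>l. vexp (c + l *s v))"
  unfolding holomorphic_disc_def
proof (intro conjI allI)
  show "(\<lambda>l. vexp (c + l *s v) $ j) holomorphic_on ball 0 1" for j
    by (auto intro!: holomorphic_intros)
next
  show "(\<lambda>l. vexp (c + l *s v)) ` ball 0 1 \<subseteq> D"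
    using assms(2) by (auto simp: vexp_in_iff[OF assms(1)])
qed

text \<open>In the purely imaginary direction \<open>2 * \<i> * \<eta>\<close>, real parameters turn
  the phases, while the logarithmic moduli move only by \<open>2 * Im l\<close> times \<eta> and
  stay in the ball. The phases \<theta> + \<eta> are reached at \<open>l = 1 / 2\<close>.\<close>

lemma lempert_rotation_le:
  assumes R: "Reinhardt D" and b: "ball x r \<subseteq> log_image D" "2 * norm \<eta> < r"
  shows "lempert D (polar x \<theta>) (polar x (\<theta> + \<eta>)) \<le> ereal (artanh (1 / 2))"
proof -
  let ?f = "\<lambda>l. vexp ((\<chi> j. Complex (x $ j) (\<theta> $ j)) + l *s (\<chi> j. 2 * \<i> * of_real (\<eta> $ j)))"
  have "holomorphic_disc D ?f"
  proof (rule holomorphic_disc_vexp[OF R])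
    fix l :: complex assume "cmod l < 1"
    then have "2 * \<bar>Im l\<bar> * norm \<eta> \<le> 2 * 1 * norm \<eta>"
      using abs_Im_le_cmod[of l] by (intro mult_right_mono) auto
    moreover have "(\<chi> j. Re ((\<chi> j. Complex (x $ j) (\<theta> $ j)) $ j + l * (\<chi> j. 2 * \<i> * of_real (\<eta> $ j)) $ j)) = x - (2 * Im l) *\<^sub>R \<eta>"
      by (simp add: vec_eq_iff)
    ultimately show "(\<chi> j. Re ((\<chi> j. Complex (x $ j) (\<theta> $ j)) $ j + l * (\<chi> j. 2 * \<i> * of_real (\<eta> $ j)) $ j)) \<in> log_image D"
      using b by (auto simp: subset_iff dist_norm)
  qed
  moreover have "?f 0 = polar x \<theta>" by (simp add: polar_def)
  moreover have "?f (1 / 2) = polar x (\<theta> + \<eta>)"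
    by (simp add: polar_def vec_eq_iff complex_eq_iff[of "Complex _ _ + _"] exp_eq_polar)
  ultimately show ?thesis
    using lempert_le[of D ?f 0 "1 / 2"] by (simp add: norm_divide)
qed

text \<open>Turning the phases in \<open>N\<close> steps, with \<open>N\<close> independent of the phases, avoids a compactness
  argument on the torus.\<close>

lemma linked_within_rotation:
  fixes D :: "(complex ^ 'n) set"
  assumes R: "Reinhardt D" and b: "ball x r \<subseteq> log_image D" "r > 0"
  obtains M where "\<And>w a \<theta>' \<theta>. linked_within D w (polar x \<theta>') a \<Longrightarrow> (\<And>j. \<bar>\<theta> $ j - \<theta>' $ j\<bar> \<le> 2 * pi) \<Longrightarrow>
    linked_within D w (polar x \<theta>) (a + M)"
proof -
  \<comment> \<open>A turn by at most \<open>2 * pi\<close> in each coordinate, cut into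
    \<open>N\<close> equal parts, meets the step condition of
    \<open>lempert_rotation_le\<close>.\<close>
  obtain N :: nat where N: "4 * pi * real CARD('n) / r < real N"
    using reals_Archimedean2 by blast
  have "0 < 4 * pi * real CARD('n) / r" using b(2) by simp
  then have "N > 0" using N by (metis less_trans of_nat_0_less_iff)
  show ?thesis
  proof (rule that)
    fix w a \<theta>' \<theta> assume w: "linked_within D w (polar x \<theta>') a" and \<theta>: "\<And>j. \<bar>\<theta> $ j - \<theta>' $ j\<bar> \<le> 2 * pi"
    define \<eta> where "\<eta> = (1 / real N) *\<^sub>R (\<theta> - \<theta>')"
    have "norm (\<theta> - \<theta>') \<le> (\<Sum>j\<in>(UNIV::'n set). 2 * pi)"
      using \<theta> by (intro order_trans[OF norm_le_l1_cart] sum_mono) simp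
    moreover have "norm \<eta> = norm (\<theta> - \<theta>') / real N"
      using \<open>N > 0\<close> by (simp add: \<eta>_def)
    ultimately have "2 * norm \<eta> \<le> 4 * pi * real CARD('n) / real N"
      using \<open>N > 0\<close> by (simp add: field_simps)
    also have "\<dots> < r" using N \<open>N > 0\<close> b(2) by (simp add: field_simps)
    finally have \<eta>: "2 * norm \<eta> < r" .
    have xG: "x \<in> log_image D" using b by auto
    have "linked_within D w (polar x (\<theta>' + real k *\<^sub>R \<eta>)) (a + real k * artanh (1 / 2))" for k
    proof (induction k)
      case (Suc k)
      have "linked_within D w (polar x (\<theta>' + real k *\<^sub>R \<eta> + \<eta>)) (a + real k * artanh (1 / 2) + artanh (1 / 2))"
        using polar_in_iff[OF R] xG by (intro linked_within_step[OF Suc _ lempert_rotation_le[OF R b(1) \<eta>]]) simp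
      then show ?case by (simp add: algebra_simps)
    qed (use w in simp)
    from this[of N] show "linked_within D w (polar x \<theta>) (a + real N * artanh (1 / 2))"
      using \<open>N > 0\<close> by (simp add: \<eta>_def)
  qed
qed

text \<open>A point whose relative gap to the boundary circle is small costs about minus half the
  logarithm of the gap. The gaps at the two ends are proportional to \<open>r / L\<close> and
  \<open>s / L\<close>, so passing through the centre of the disc adds up to the stated
  bound.\<close>

lemma linked_within_segment:
  fixes D :: "(complex ^ 'n) set"
  assumes R: "Reinhardt D" and conv: "convex (log_image D)"
    and br: "ball x0 r \<subseteq> log_image D" "0 < r" "r \<le> 1" and bs: "ball x s \<subseteq> log_image D" "0 < s" "s \<le> 1"
    and L: "norm (x - x0) \<le> L" "1 \<le> L"
    and w: "linked_within D w (polar x0 \<theta>) a"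
  shows "linked_within D w (polar x \<theta>) (a + ln (4 * L) - ln r / 2 - ln s / 2)"
proof -
  \<comment> \<open>The prolongations, as fractions of \<open>v\<close>: their lengths are at most
    \<open>r / 2\<close> and \<open>s / 2\<close>, so both new endpoints lie in the given
    balls.\<close>
  define \<alpha> where "\<alpha> = r / (2 * L)"
  define \<beta> where "\<beta> = s / (2 * L)"
  have \<alpha>: "0 < \<alpha>" "\<alpha> \<le> 1 / 2" and \<beta>: "0 < \<beta>" "\<beta> \<le> 1 / 2"
    using br bs L by (simp_all add: \<alpha>_def \<beta>_def field_simps)
  \<comment> \<open>Centre and radius of the disc in the parameter plane with diameter from
    \<open>- \<alpha>\<close> to \<open>1 + \<beta>\<close>; the original endpoints sit at
    parameters \<open>0\<close> and \<open>1\<close>.\<close>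
  define c where "c = (1 + \<beta> - \<alpha>) / 2"
  define \<rho> where "\<rho> = (1 + \<alpha> + \<beta>) / 2"
  define v where "v = x - x0"
  have c: "0 < c" "c < \<rho>" "0 < 1 - c" "1 - c < \<rho>" "\<rho> > 0"
    using \<alpha> \<beta> unfolding c_def \<rho>_def by (simp_all add: field_simps)
  have half: "k / (2 * L) * norm v \<le> k / 2" if "0 < k" for k
    using L that by (simp add: v_def field_simps)
  have "norm (\<alpha> *\<^sub>R v) < r"
    using half[OF br(2), folded \<alpha>_def] \<alpha>(1) br(2) by simp
  then have e0: "x0 - \<alpha> *\<^sub>R v \<in> log_image D"
    using br(1) by (auto simp: subset_iff dist_norm)
  have "norm (\<beta> *\<^sub>R v) < s"
    using half[OF bs(2), folded \<beta>_def] \<beta>(1) bs(2) by simp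
  then have e1: "x + \<beta> *\<^sub>R v \<in> log_image D"
    using bs(1) by (auto simp: subset_iff dist_norm)
  let ?p = "(\<chi> j. Complex (x0 $ j) (\<theta> $ j)) :: complex ^ 'n"
  let ?f = "\<lambda>l. vexp ((?p + of_real c *s cplx v) + l *s (of_real \<rho> *s cplx v))"
  have hol: "holomorphic_disc D ?f"
  proof (rule holomorphic_disc_vexp[OF R])
    fix l :: complex assume l: "cmod l < 1"
    define t where "t = c + \<rho> * Re l"
    have "\<bar>Re l\<bar> < 1" using l abs_Re_le_cmod order.strict_trans1 by blast
    then have "\<rho> * (-1) < \<rho> * Re l" "\<rho> * Re l < \<rho> * 1"
      using c(5) by (intro mult_strict_left_mono; simp)+
    then have t: "- \<alpha> \<le> t" "t \<le> 1 + \<beta>" by (simp_all add: t_def c_def \<rho>_def field_simps)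
    define u where "u = (t + \<alpha>) / (1 + \<alpha> + \<beta>)"
    have u: "0 \<le> u" "u \<le> 1" "u * (1 + \<alpha> + \<beta>) = t + \<alpha>"
      using t \<alpha> \<beta> by (auto simp: u_def field_simps)
    have "(1 - u) *\<^sub>R (x0 - \<alpha> *\<^sub>R v) + u *\<^sub>R (x + \<beta> *\<^sub>R v) \<in> log_image D"
      using u by (intro convexD[OF conv e0 e1]) auto
    also have "(1 - u) *\<^sub>R (x0 - \<alpha> *\<^sub>R v) + u *\<^sub>R (x + \<beta> *\<^sub>R v) = x0 + (u * (1 + \<alpha> + \<beta>) - \<alpha>) *\<^sub>R v"
      by (simp add: v_def algebra_simps)
    also have "\<dots> = (\<chi> j. Re ((?p + of_real c *s cplx v) $ j + l * (of_real \<rho> *s cplx v) $ j))"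
      using u(3) by (simp add: vec_eq_iff t_def algebra_simps)
    finally show "(\<chi> j. Re ((?p + of_real c *s cplx v) $ j + l * (of_real \<rho> *s cplx v) $ j)) \<in> log_image D" .
  qed
  have f0: "?f (of_real (- c / \<rho>)) = polar x0 \<theta>"
    using c(5) by (simp add: polar_def vec_eq_iff)
  have "Complex (x0 $ j) (\<theta> $ j) + of_real (v $ j) = Complex (x $ j) (\<theta> $ j)" for j
    by (simp add: v_def complex_eq_iff)
  then have f1: "?f (of_real ((1 - c) / \<rho>)) = polar x \<theta>"
    using c(5) by (simp add: polar_def vec_eq_iff)
  have gap: "\<rho> - c = \<alpha>" "\<rho> - (1 - c) = \<beta>" "\<rho> + c \<le> 2" "\<rho> + (1 - c) \<le> 2"
    using \<alpha> \<beta> unfolding \<rho>_def c_def by (simp_all add: field_simps)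
  \<comment> \<open>By \<open>artanh\<close>, the cost is half the logarithm of
    \<open>(\<rho> + y) / (\<rho> - y)\<close>, whose denominator is the gap at the corresponding
    end.\<close>
  have artanh_le: "artanh (y / \<rho>) \<le> ln (4 * L / k) / 2"
    if "0 < y" "y < \<rho>" "0 < k" "\<rho> - y = k / (2 * L)" "\<rho> + y \<le> 2" for y k
  proof -
    have "(1 + y / \<rho>) / (1 - y / \<rho>) = (\<rho> + y) / (\<rho> - y)"
      using c(5) that(1,2) by (simp add: field_simps)
    also have "\<dots> \<le> 2 / (\<rho> - y)"
      using that by (intro divide_right_mono) auto
    also have "\<dots> = 4 * L / k" using that(4) by simp
    finally have "(1 + y / \<rho>) / (1 - y / \<rho>) \<le> 4 * L / k" .
    moreover have "0 < (1 + y / \<rho>) / (1 - y / \<rho>)"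
      using c(5) that(1,2) by (intro divide_pos_pos) (auto simp: field_simps)
    ultimately show ?thesis by (simp add: artanh_def)
  qed
  have "artanh (c / \<rho>) \<le> ln (4 * L / r) / 2"
    using c br(2) gap by (intro artanh_le) (simp_all add: \<alpha>_def)
  then have l0: "lempert D (polar x0 \<theta>) (?f 0) \<le> ereal (ln (4 * L / r) / 2)"
    using lempert_le[OF hol _ _ f0 refl, of 0] c by (simp add: norm_divide order_trans)
  have "artanh ((1 - c) / \<rho>) \<le> ln (4 * L / s) / 2"
    using c bs(2) gap by (intro artanh_le) (simp_all add: \<beta>_def)
  moreover have "cmod (of_real ((1 - c) / \<rho>)) = (1 - c) / \<rho>"
    using c by (simp only: norm_of_real) simp
  ultimately have l1: "lempert D (?f 0) (polar x \<theta>) \<le> ereal (ln (4 * L / s) / 2)"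
    using lempert_le[OF hol _ _ refl f1, of 0] c by (simp add: order_trans)
  have "?f ` ball 0 1 \<subseteq> D" using hol unfolding holomorphic_disc_def by blast
  then have "?f 0 \<in> D" by (rule subsetD) (rule imageI, simp)
  moreover have "polar x \<theta> \<in> D" using bs(1,2) by (auto simp: polar_in_iff[OF R])
  ultimately have "linked_within D w (polar x \<theta>) (a + ln (4 * L / r) / 2 + ln (4 * L / s) / 2)"
    using linked_within_step[OF linked_within_step[OF w _ l0] _ l1] by blast
  also have "a + ln (4 * L / r) / 2 + ln (4 * L / s) / 2 = a + ln (4 * L) - ln r / 2 - ln s / 2"
    using L(2) br(2) bs(2) by (simp add: ln_div diff_divide_distrib)
  finally show ?thesis .
qed

section \<open>Estimates near the boundary\<close>

text \<open>Changing a logarithmic modulus by \<open>u\<close> multiplies the coordinate by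
  \<open>exp u\<close>, which moves it by at most \<open>2 * \<Lambda> * \<bar>u\<bar>\<close> for
  small \<open>u\<close>. The radius is chosen so that these moves add up to half the boundary
  distance.\<close>

lemma ball_log_vec_subset:
  fixes D :: "(complex ^ 'n) set"
  assumes R: "Reinhardt D" and w: "w \<in> D" "\<And>j. w $ j \<noteq> 0" "\<And>j. cmod (w $ j) \<le> \<Lambda>" "\<Lambda> \<ge> 1"
    and d: "0 < bdist D w" "bdist D w \<le> 1"
  shows "ball (log_vec w) (bdist D w / (4 * real CARD('n) * \<Lambda>)) \<subseteq> log_image D"
proof
  let ?x = "log_vec w" and ?d = "bdist D w" and ?n = "real CARD('n)"
  define s where "s = ?d / (4 * ?n * \<Lambda>)"
  have n: "?n \<ge> 1" by (simp add: Suc_leI)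
  then have "1 \<le> ?n * \<Lambda>" using w(4) mult_mono[of 1 ?n 1 \<Lambda>] by simp
  then have "s \<le> 1 / 2"
    unfolding s_def using d by (simp add: field_simps)
  fix y assume "y \<in> ball ?x (?d / (4 * ?n * \<Lambda>))"
  then have y: "norm (y - ?x) < s" by (simp add: s_def dist_norm norm_minus_commute)
  have exp_bound: "\<bar>exp u - 1\<bar> \<le> 2 * \<bar>u\<bar>" if "\<bar>u\<bar> \<le> 1 / 2" for u :: real
  proof -
    have "1 + u \<le> exp u" by (rule exp_ge_add_one_self)
    moreover have "exp u \<le> 1 + 2 * \<bar>u\<bar>" using exp_bound_lemma[of u] that by simp
    ultimately show ?thesis by linarith
  qed
  define z where "z = polar y (\<chi> j. Arg (w $ j))"
  have "cmod ((z - w) $ j) \<le> 2 * \<Lambda> * s" for j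
  proof -
    define u where "u = y $ j - ln (cmod (w $ j))"
    have u: "\<bar>u\<bar> \<le> s"
      using component_le_norm_cart[of "y - ?x" j] y by (simp add: u_def)
    have "w $ j = polar ?x (\<chi> j. Arg (w $ j)) $ j"
      using polar_log_vec[of w] w(2) by simp
    moreover have "z $ j = polar ?x (\<chi> j. Arg (w $ j)) $ j * of_real (exp u)"
      by (simp add: z_def polar_def u_def Complex_eq exp_add exp_diff flip: exp_of_real)
    ultimately have "(z - w) $ j = w $ j * of_real (exp u - 1)"
      by (simp add: algebra_simps)
    then have "cmod ((z - w) $ j) = cmod (w $ j) * \<bar>exp u - 1\<bar>"
      by (simp add: norm_mult del: of_real_diff)
    also have "\<dots> \<le> \<Lambda> * (2 * s)"
      using exp_bound[of u] u \<open>s \<le> 1 / 2\<close> w(3)[of j] w(4) by (intro mult_mono) auto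
    finally show ?thesis by simp
  qed
  then have "norm (z - w) \<le> (\<Sum>j\<in>(UNIV :: 'n set). 2 * \<Lambda> * s)"
    by (intro order_trans[OF norm_cvec_le_sum] sum_mono)
  also have "\<dots> = ?d / 2" using n w(4) by (simp add: s_def field_simps)
  also have "\<dots> < ?d" using d by simp
  finally have "z \<in> D"
    using ball_bdist_subset[OF w(1)] by (auto simp: dist_norm norm_minus_commute)
  then show "y \<in> log_image D" by (simp add: z_def polar_in_iff[OF R])
qed

text \<open>The chain goes from \<open>z0\<close> to a nearby point \<open>z1\<close> without zero
  coordinates, turns its phases into those of \<open>w\<close>, and then follows the logarithmic
  segment to \<open>w\<close>. The cost of the first two stages is bounded independently of
  \<open>w\<close>, so \<open>C\<close> is uniform.\<close>

lemma linked_within_log_bound: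
  fixes D :: "(complex ^ 'n) set"
  assumes R: "Reinhardt D" and conv: "convex (log_image D)" and F: "frontier D \<noteq> {}" and z0: "z0 \<in> D"
  obtains C where "\<And>w \<Lambda> L. w \<in> D \<Longrightarrow> (\<And>j. w $ j \<noteq> 0) \<Longrightarrow> (\<And>j. cmod (w $ j) \<le> \<Lambda>) \<Longrightarrow> 1 \<le> \<Lambda> \<Longrightarrow>
    bdist D w \<le> 1 \<Longrightarrow> norm (log_vec w) \<le> L \<Longrightarrow> 1 \<le> L \<Longrightarrow>
    linked_within D z0 w (ln L + ln \<Lambda> / 2 - ln (bdist D w) / 2 + C)"
proof -
  let ?n = "real CARD('n)"
  have oD: "open D" by (rule Reinhardt_open[OF R])
  have d0: "bdist D z0 > 0" by (rule bdist_pos[OF oD z0 F])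
  define \<kappa> where "\<kappa> = bdist D z0 / (4 * ?n)"
  have "\<kappa> > 0" using d0 by (simp add: \<kappa>_def)
  then obtain z1 where z1: "\<And>j. \<kappa> \<le> cmod (z1 $ j)" "norm (z1 - z0) \<le> 2 * \<kappa> * ?n"
    using nonzero_perturbation by blast
  have z1nz: "z1 $ j \<noteq> 0" for j using z1(1)[of j] \<open>\<kappa> > 0\<close> by auto
  have "2 * norm (z1 - z0) \<le> bdist D z0" using z1(2) by (simp add: \<kappa>_def)
  note z1D = lempert_ball_le[OF z0 d0 this]
  define x0 where "x0 = log_vec z1"
  have "x0 \<in> log_image D" using z1D(3) mem_iff_log_vec[OF R z1nz] by (simp add: x0_def)
  then obtain r0 where "r0 > 0" "ball x0 r0 \<subseteq> log_image D"
    using open_log_image[OF oD] open_contains_ball by blast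
  then obtain r where r: "0 < r" "r \<le> 1" "ball x0 r \<subseteq> log_image D"
    using subset_ball[of "min r0 1" r0 x0] that by (metis dual_order.trans min.cobounded1 min.cobounded2 min_less_iff_conj zero_less_one)
  obtain M where M: "\<And>w a \<theta>' \<theta>. linked_within D w (polar x0 \<theta>') a \<Longrightarrow> (\<And>j. \<bar>\<theta> $ j - \<theta>' $ j\<bar> \<le> 2 * pi) \<Longrightarrow>
    linked_within D w (polar x0 \<theta>) (a + M)"
    using linked_within_rotation[OF R r(3,1)] by metis
  define a where "a = artanh (1 / 2) + M"
  have torus: "linked_within D z0 (polar x0 (\<chi> j. Arg (w $ j))) a" for w :: "complex ^ 'n"
    unfolding a_def
  proof (rule M)
    show "linked_within D z0 (polar x0 (\<chi> j. Arg (z1 $ j))) (artanh (1 / 2))"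
      unfolding x0_def polar_log_vec[OF z1nz] by (rule linked_within_single[OF z0 z1D(3,1)])
    show "\<bar>(\<chi> j. Arg (w $ j)) $ j - (\<chi> j. Arg (z1 $ j)) $ j\<bar> \<le> 2 * pi" for j
      using Arg_bounded[of "w $ j"] Arg_bounded[of "z1 $ j"] by auto
  qed
  show ?thesis
  proof (rule that)
    fix w :: "complex ^ 'n" and \<Lambda> L :: real
    assume w: "w \<in> D" "\<And>j. w $ j \<noteq> 0" "\<And>j. cmod (w $ j) \<le> \<Lambda>" "1 \<le> \<Lambda>" "bdist D w \<le> 1"
      and L: "norm (log_vec w) \<le> L" "1 \<le> L"
    have d: "bdist D w > 0" by (rule bdist_pos[OF oD w(1) F])
    define s where "s = bdist D w / (4 * ?n * \<Lambda>)"
    have n: "?n \<ge> 1" by (simp add: Suc_leI)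
    then have "1 \<le> ?n * \<Lambda>" using w(4) mult_mono[of 1 ?n 1 \<Lambda>] by simp
    then have s: "0 < s" "s \<le> 1"
      unfolding s_def using d w(5) n by (simp_all add: field_simps)
    \<comment> \<open>A product rather than a sum, so that its logarithm splits into
      \<open>ln L\<close> and a constant.\<close>
    define L' where "L' = L * (1 + norm x0)"
    have "L * 1 \<le> L'" unfolding L'_def using L by (intro mult_left_mono) auto
    moreover have "norm (log_vec w - x0) \<le> L + norm x0"
      using norm_triangle_ineq4[of "log_vec w" x0] L by linarith
    moreover have "L + norm x0 \<le> L'"
      using L(2) mult_right_mono[of 1 L "norm x0"] by (simp add: L'_def algebra_simps)
    ultimately have L': "norm (log_vec w - x0) \<le> L'" "1 \<le> L'" using L by linarith+
    have "linked_within D z0 (polar (log_vec w) (\<chi> j. Arg (w $ j))) (a + ln (4 * L') - ln r / 2 - ln s / 2)"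
      using ball_log_vec_subset[OF R w(1-4) d w(5)]
      by (intro linked_within_segment[OF R conv r(3,1,2) _ s L' torus]) (simp add: s_def)
    also have "polar (log_vec w) (\<chi> j. Arg (w $ j)) = w" by (rule polar_log_vec[OF w(2)])
    also have "a + ln (4 * L') - ln r / 2 - ln s / 2 =
      ln L + ln \<Lambda> / 2 - ln (bdist D w) / 2 + (a + ln 4 + ln (1 + norm x0) - ln r / 2 + ln (4 * ?n) / 2)"
    proof -
      have "0 < 1 + norm x0" by (simp add: add_pos_nonneg)
      then have "ln (4 * L') = ln 4 + ln L + ln (1 + norm x0)"
        using L by (simp add: L'_def ln_mult)
      moreover have "ln s = ln (bdist D w) - ln (4 * ?n) - ln \<Lambda>"
        using d n w(4) by (simp add: s_def ln_div ln_mult)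
      ultimately show ?thesis by (simp add: field_simps)
    qed
    finally show "linked_within D z0 w
      (ln L + ln \<Lambda> / 2 - ln (bdist D w) / 2 + (a + ln 4 + ln (1 + norm x0) - ln r / 2 + ln (4 * ?n) / 2))" .
  qed
qed

lemma norm_log_vec_le:
  fixes w :: "complex ^ 'n"
  assumes "\<And>j. \<mu> \<le> cmod (w $ j)" "\<And>j. cmod (w $ j) \<le> \<Lambda>" "0 < \<mu>" "1 \<le> \<Lambda>" "\<mu> \<le> 1"
  shows "norm (log_vec w) \<le> real CARD('n) * (ln \<Lambda> - ln \<mu>)"
proof -
  have "\<bar>log_vec w $ j\<bar> \<le> ln \<Lambda> - ln \<mu>" for j
  proof -
    have "0 < cmod (w $ j)" using assms(1)[of j] assms(3) by linarith
    then have "ln \<mu> \<le> ln (cmod (w $ j))" "ln (cmod (w $ j)) \<le> ln \<Lambda>"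
      using assms by simp_all
    moreover have "ln \<mu> \<le> 0" "0 \<le> ln \<Lambda>" using assms by simp_all
    ultimately show ?thesis by simp
  qed
  then have "norm (log_vec w) \<le> (\<Sum>j\<in>(UNIV :: 'n set). ln \<Lambda> - ln \<mu>)"
    by (intro order_trans[OF norm_le_l1_cart] sum_mono)
  then show ?thesis by simp
qed

theorem theorem1:
  fixes D :: "(complex ^ 'n) set" and z0 \<zeta>0 :: "complex ^ 'n"
  assumes "Reinhardt D" and "pseudoconvex D"
    and "z0 \<in> D" and "\<zeta>0 \<in> frontier D"
  shows "(\<exists>C::real. \<exists>U. open U \<and> \<zeta>0 \<in> U \<and>
            (\<forall>z \<in> D \<inter> U. kobayashi D z0 z \<le> ereal (- ln (bdist D z) + C))) \<and>
         ((\<forall>j. \<zeta>0 $ j \<noteq> 0) \<longrightarrow>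
            (\<exists>C'::real. \<exists>U'. open U' \<and> \<zeta>0 \<in> U' \<and>
               (\<forall>z \<in> D \<inter> U'. kobayashi D z0 z \<le> ereal (- (1/2) * ln (bdist D z) + C'))))"
proof -
  let ?n = "real CARD('n)"
  have n: "?n \<ge> 1" by (simp add: Suc_leI)
  have F: "frontier D \<noteq> {}" using assms(4) by blast
  then have "plurisubharmonic_on D (\<lambda>z. - ln (bdist D z))"
    using assms(2) by (auto simp: pseudoconvex_def)
  then have conv: "convex (log_image D)"
    by (rule convex_log_image[OF assms(1) _ F])
  define \<Lambda> where "\<Lambda> = norm \<zeta>0 + 3"
  have \<Lambda>: "\<Lambda> \<ge> 1" by (simp add: \<Lambda>_def)
  obtain C where C: "\<And>w L. w \<in> D \<Longrightarrow> (\<And>j. w $ j \<noteq> 0) \<Longrightarrow> (\<And>j. cmod (w $ j) \<le> \<Lambda>) \<Longrightarrow>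
    bdist D w \<le> 1 \<Longrightarrow> norm (log_vec w) \<le> L \<Longrightarrow> 1 \<le> L \<Longrightarrow>
    linked_within D z0 w (ln L - ln (bdist D w) / 2 + C)"
  proof -
    obtain C0 where C0: "\<And>w L. w \<in> D \<Longrightarrow> (\<And>j. w $ j \<noteq> 0) \<Longrightarrow> (\<And>j. cmod (w $ j) \<le> \<Lambda>) \<Longrightarrow>
      bdist D w \<le> 1 \<Longrightarrow> norm (log_vec w) \<le> L \<Longrightarrow> 1 \<le> L \<Longrightarrow>
      linked_within D z0 w (ln L + ln \<Lambda> / 2 - ln (bdist D w) / 2 + C0)"
      using linked_within_log_bound[OF assms(1) conv F assms(3)] \<Lambda> by metis
    have "linked_within D z0 w (ln L - ln (bdist D w) / 2 + (ln \<Lambda> / 2 + C0))"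
      if "w \<in> D" "\<And>j. w $ j \<noteq> 0" "\<And>j. cmod (w $ j) \<le> \<Lambda>" "bdist D w \<le> 1" "norm (log_vec w) \<le> L" "1 \<le> L" for w L
      using C0[OF that] by (simp add: algebra_simps)
    then show ?thesis by (rule that)
  qed
  have d: "bdist D z > 0" if "z \<in> D" for z
    by (rule bdist_pos[OF Reinhardt_open[OF assms(1)] that F])
  have d_le: "bdist D z \<le> dist z \<zeta>0" for z
    unfolding bdist_def by (rule infdist_le[OF assms(4)])
  have \<Lambda>_bound: "cmod (w $ j) \<le> \<Lambda>" if "dist w \<zeta>0 \<le> 3" for w j
  proof -
    have "cmod (w $ j) \<le> norm w" by (rule Finite_Cartesian_Product.norm_nth_le)
    also have "\<dots> \<le> norm \<zeta>0 + 3" using that norm_triangle_sub[of w \<zeta>0] by (simp add: dist_norm)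
    finally show ?thesis by (simp add: \<Lambda>_def)
  qed
  show ?thesis
  proof (intro conjI impI)
    \<comment> \<open>The part of the bound on \<open>norm (log_vec w)\<close> that stays constant
      as the boundary distance shrinks.\<close>
    define A where "A = 1 + ?n * (ln \<Lambda> + ln (8 * ?n))"
    define C1 where "C1 = ln (A + 2 * ?n) + ln 2 / 2 + C + artanh (1 / 2)"
    have "ln \<Lambda> \<ge> 0" "ln (8 * ?n) \<ge> 0" using n \<Lambda> by (simp, intro ln_ge_zero, linarith)
    then have A: "A \<ge> 1" unfolding A_def by simp
    have "kobayashi D z0 z \<le> ereal (- ln (bdist D z) + C1)" if z: "z \<in> D" "z \<in> ball \<zeta>0 (1/2)" for z
    proof -
      let ?d = "bdist D z"
      have d1: "0 < ?d" "?d < 1 / 2" using d[OF z(1)] d_le[of z] z(2) by (auto simp: dist_commute)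
      define t where "t = - ln ?d"
      have t: "t \<ge> 0" using d1 by (simp add: t_def)
      \<comment> \<open>The perturbation moves \<open>z\<close> by at most \<open>?d / 4\<close>:
        one disc of fixed cost joins \<open>w\<close> to \<open>z\<close>, at least half of the
        boundary distance survives, and the moduli of \<open>w\<close> are bounded below by a
        multiple of \<open>?d\<close>.\<close>
      define \<kappa> where "\<kappa> = ?d / (8 * ?n)"
      have "?d \<le> 8 * ?n" using d1 n by linarith
      then have \<kappa>: "\<kappa> > 0" "\<kappa> \<le> 1" using d1 by (simp_all add: \<kappa>_def)
      obtain w where w: "\<And>j. \<kappa> \<le> cmod (w $ j)" "norm (w - z) \<le> 2 * \<kappa> * ?n"
        using nonzero_perturbation[OF \<kappa>(1)] by blast
      have wz: "norm (w - z) \<le> ?d / 4" using w(2) by (simp add: \<kappa>_def)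
      then have "2 * norm (w - z) \<le> ?d" using d1 by linarith
      note wD = lempert_ball_le[OF z(1) d1(1) this]
      have dw: "?d / 2 \<le> bdist D w" "bdist D w \<le> 1"
      proof -
        show "?d / 2 \<le> bdist D w"
          using bdist_triangle[of D z w] wz d1 by (simp add: dist_norm norm_minus_commute)
        show "bdist D w \<le> 1"
          using bdist_triangle[of D w z] wz d1 by (simp add: dist_norm)
      qed
      have "dist w \<zeta>0 \<le> 3"
        using dist_triangle[of w \<zeta>0 z] wz d1 z(2) by (simp add: dist_norm norm_minus_commute)
      note wB = \<Lambda>_bound[OF this]
      have "norm (log_vec w) \<le> ?n * (ln \<Lambda> - ln \<kappa>)"
        by (rule norm_log_vec_le[OF w(1) wB \<kappa>(1) \<Lambda> \<kappa>(2)])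
      also have "\<dots> \<le> A + ?n * t"
        using d1 n by (simp add: A_def \<kappa>_def t_def ln_div algebra_simps)
      \<comment> \<open>The shape \<open>1 + t / 2\<close> is chosen because its logarithm is at
        most \<open>t / 2\<close>, exactly the half of \<open>- ln ?d\<close> still
        available.\<close>
      also have "\<dots> \<le> (A + 2 * ?n) * (1 + t / 2)"
        using A n t by (simp add: algebra_simps)
      finally have normL: "norm (log_vec w) \<le> (A + 2 * ?n) * (1 + t / 2)" .
      have L1: "1 \<le> (A + 2 * ?n) * (1 + t / 2)"
        using mult_mono[of 1 "A + 2 * ?n" 1 "1 + t / 2"] A n t by simp
      have "w $ j \<noteq> 0" for j using w(1)[of j] \<kappa>(1) by auto
      then have "linked_within D z0 w (ln ((A + 2 * ?n) * (1 + t / 2)) - ln (bdist D w) / 2 + C)"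
        by (rule C[OF wD(3) _ wB dw(2) normL L1])
      then have "linked_within D z0 z (ln ((A + 2 * ?n) * (1 + t / 2)) - ln (bdist D w) / 2 + C + artanh (1 / 2))"
        by (rule linked_within_step[OF _ z(1) wD(2)])
      moreover have "ln ((A + 2 * ?n) * (1 + t / 2)) - ln (bdist D w) / 2 + C + artanh (1 / 2) \<le> - ln ?d + C1"
      proof -
        have "ln ((A + 2 * ?n) * (1 + t / 2)) = ln (A + 2 * ?n) + ln (1 + t / 2)"
          using A n t by (intro ln_mult_pos) auto
        moreover have "ln (1 + t / 2) \<le> t / 2" using t by (intro ln_add_one_self_le_self) simp
        moreover have "ln (?d / 2) \<le> ln (bdist D w)" using dw(1) d1 by simp
        moreover have "ln (?d / 2) = ln ?d - ln 2" using d1 by (simp add: ln_div)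
        ultimately show ?thesis by (simp add: C1_def t_def)
      qed
      ultimately show ?thesis using kobayashi_le linked_within_mono by blast
    qed
    then show "\<exists>C U. open U \<and> \<zeta>0 \<in> U \<and> (\<forall>z\<in>D \<inter> U. kobayashi D z0 z \<le> ereal (- ln (bdist D z) + C))"
      by (intro exI[of _ C1] exI[of _ "ball \<zeta>0 (1/2)"]) auto
  next
    assume nz: "\<forall>j. \<zeta>0 $ j \<noteq> 0"
    \<comment> \<open>Half the least modulus of \<zeta>0, capped at \<open>1 / 2\<close>: within
      distance \<mu> of \<zeta>0 every coordinate keeps modulus at least \<mu>.\<close>
    define \<mu> where "\<mu> = Min (insert 1 (range (\<lambda>j. cmod (\<zeta>0 $ j)))) / 2"
    have "2 * \<mu> > 0" "2 * \<mu> \<le> 1" using nz by (auto simp: \<mu>_def)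
    have \<mu>_le: "2 * \<mu> \<le> cmod (\<zeta>0 $ j)" for j
    proof -
      have "Min (insert 1 (range (\<lambda>j. cmod (\<zeta>0 $ j)))) \<le> cmod (\<zeta>0 $ j)"
        by (intro Min_le) auto
      then show ?thesis by (simp only: \<mu>_def)
    qed
    have \<mu>: "0 < \<mu>" "\<mu> \<le> 1"
      using \<open>2 * \<mu> > 0\<close> \<open>2 * \<mu> \<le> 1\<close> by linarith+
    \<comment> \<open>Here the logarithmic coordinates are bounded near \<zeta>0, so
      \<open>ln L\<close> joins the constant and only half of the logarithm of the boundary distance
      remains.\<close>
    define L where "L = 1 + ?n * (ln \<Lambda> - ln \<mu>)"
    have "?n * (ln \<Lambda> - ln \<mu>) \<ge> 0" using \<mu> \<Lambda> by simp
    have "kobayashi D z0 z \<le> ereal (- (1/2) * ln (bdist D z) + (ln L + C))" if z: "z \<in> D" "z \<in> ball \<zeta>0 \<mu>" for z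
    proof -
      have z\<zeta>: "dist z \<zeta>0 < \<mu>" using z(2) by (simp add: dist_commute)
      then have zB: "\<And>j. cmod (z $ j) \<le> \<Lambda>" using \<mu> by (intro \<Lambda>_bound) simp
      have z\<mu>: "\<mu> \<le> cmod (z $ j)" for j
      proof -
        have "cmod (\<zeta>0 $ j) - cmod (z $ j) \<le> cmod ((\<zeta>0 - z) $ j)"
          using norm_triangle_ineq2 by simp
        also have "\<dots> \<le> norm (\<zeta>0 - z)" by (rule Finite_Cartesian_Product.norm_nth_le)
        finally show ?thesis using \<mu>_le[of j] z\<zeta> by (simp add: dist_norm norm_minus_commute)
      qed
      have "norm (log_vec z) \<le> L"
        using norm_log_vec_le[OF z\<mu> zB \<mu>(1) \<Lambda> \<mu>(2)] by (simp add: L_def)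
      moreover have "z $ j \<noteq> 0" for j using z\<mu>[of j] \<mu>(1) by auto
      moreover have "bdist D z \<le> 1" using d_le[of z] z\<zeta> \<mu> by simp
      moreover have "1 \<le> L" using \<open>?n * (ln \<Lambda> - ln \<mu>) \<ge> 0\<close> by (simp add: L_def)
      ultimately have "linked_within D z0 z (ln L - ln (bdist D z) / 2 + C)"
        using zB by (intro C[OF z(1)]) auto
      then show ?thesis using kobayashi_le by (fastforce simp: algebra_simps)
    qed
    then show "\<exists>C' U'. open U' \<and> \<zeta>0 \<in> U' \<and> (\<forall>z\<in>D \<inter> U'. kobayashi D z0 z \<le> ereal (- (1/2) * ln (bdist D z) + C'))"
      using \<mu>(1) by (intro exI[of _ "ln L + C"] exI[of _ "ball \<zeta>0 \<mu>"]) auto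
  qed
qed

end
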